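(* Let $\mathcal G$ be a second-countable ample groupoid and $S$ a semifield. Then the Steinberg algebra $A_S(\mathcal G)$ is congruence-simple if and only if all of the following hold: (1) $S$ is either a field or the Boolean semifield $\mathbb B$; (2) $\mathcal G$ is both minimal and effective; (3) for any two distinct elements $f,g\in A_S(\mathcal G)$, the set $\operatorname{Eq}(f,g)=\{\alpha\in\mathcal G: f(\alpha)=g(\alpha)\}$ is not dense in $\mathcal G$.
   Context: A semifield is a nontrivial commutative semiring (commutative monoid addition with $0$, commutative associative multiplication with $1$, distributivity, absorbing $0$) in which every nonzero element is invertible; $\mathbb B=(\{0,1\},\text{or},\text{and})$. An ample groupoid is a topological groupoid whose unit space $\mathcal G^{(0)}$ is locally compact Hausdorff and totally disconnected and whose source and range maps $s,r$ are local homeomorphisms ($\mathcal G$ need not be Hausdorff). $\mathcal G$ is minimal if $\mathcal G^{(0)}$ has no open invariant subsets other than $\varnothing$ and $\mathcal G^{(0)}$ (where $D\subseteq\mathcal G^{(0)}$ is invariant if $s(\gamma)\in D$ implies $r(\gamma)\in D$); $\mathcal G$ is effective if the interior of $\{\gamma: s(\gamma)=r(\gamma)\}$ equals $\mathcal G^{(0)}$. The Steinberg algebra $A_S(\mathcal G)$ is the set of functions $\mathcal G\to S$ of the form $\sum_{U\in F}s_U1_U$ with $F$ a finite set of compact open bisections (subsets on which $s,r$ are homeomorphisms onto their images), with pointwise addition and convolution $(f*g)(\gamma)=\sum_{\alpha\beta=\gamma}f(\alpha)g(\beta)$. A hemiring is congruence-simple if its only congruences (equivalence relations compatible with addition and left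 and right multiplication) are the full relation and the diagonal. *)

theory Defs
  imports "HOL-Analysis.Analysis"
begin

text \<open>A groupoid is given by its underlying space T (the set of arrows is topspace T),
  the unit space G0, source s, range r, partial multiplication m (defined on pairs
  (a,b) with s a = r b, i.e. a b with b applied first) and inversion i.\<close>

definition composable_pairs :: "'g topology \<Rightarrow> ('g \<Rightarrow> 'g) \<Rightarrow> ('g \<Rightarrow> 'g) \<Rightarrow> ('g \<times> 'g) set" where
  "composable_pairs T s r = {(a, b). a \<in> topspace T \<and> b \<in> topspace T \<and> s a = r b}"

definition groupoid ::
  "'g topology \<Rightarrow> 'g set \<Rightarrow> ('g \<Rightarrow> 'g) \<Rightarrow> ('g \<Rightarrow> 'g) \<Rightarrow> ('g \<Rightarrow> 'g \<Rightarrow> 'g) \<Rightarrow> ('g \<Rightarrow> 'g) \<Rightarrow> bool" where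
  "groupoid T G0 s r m i \<longleftrightarrow>
     G0 \<subseteq> topspace T \<and>
     (\<forall>a \<in> topspace T. s a \<in> G0 \<and> r a \<in> G0) \<and>
     (\<forall>u \<in> G0. s u = u \<and> r u = u) \<and>
     (\<forall>a \<in> topspace T. \<forall>b \<in> topspace T. s a = r b \<longrightarrow>
        m a b \<in> topspace T \<and> s (m a b) = s b \<and> r (m a b) = r a) \<and>
     (\<forall>a \<in> topspace T. \<forall>b \<in> topspace T. \<forall>c \<in> topspace T. s a = r b \<longrightarrow> s b = r c \<longrightarrow>
        m (m a b) c = m a (m b c)) \<and>
     (\<forall>a \<in> topspace T. m (r a) a = a \<and> m a (s a) = a) \<and>
     (\<forall>a \<in> topspace T. i a \<in> topspace T \<and> s (i a) = r a \<and> r (i a) = s a \<and>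
        m a (i a) = r a \<and> m (i a) a = s a)"

definition topological_groupoid ::
  "'g topology \<Rightarrow> 'g set \<Rightarrow> ('g \<Rightarrow> 'g) \<Rightarrow> ('g \<Rightarrow> 'g) \<Rightarrow> ('g \<Rightarrow> 'g \<Rightarrow> 'g) \<Rightarrow> ('g \<Rightarrow> 'g) \<Rightarrow> bool" where
  "topological_groupoid T G0 s r m i \<longleftrightarrow>
     groupoid T G0 s r m i \<and>
     continuous_map (subtopology (prod_topology T T) (composable_pairs T s r)) T (\<lambda>(a, b). m a b) \<and>
     continuous_map T T i"

definition totally_disconnected_space :: "'a topology \<Rightarrow> bool" where
  "totally_disconnected_space X \<longleftrightarrow>
     (\<forall>x \<in> topspace X. connected_component_of_set X x = {x})"

definition local_homeomorphism :: "'a topology \<Rightarrow> 'b topology \<Rightarrow> ('a \<Rightarrow> 'b) \<Rightarrow> bool" where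
  "local_homeomorphism X Y f \<longleftrightarrow>
     f ` topspace X \<subseteq> topspace Y \<and>
     (\<forall>x \<in> topspace X. \<exists>U. openin X U \<and> x \<in> U \<and> openin Y (f ` U) \<and>
        homeomorphic_map (subtopology X U) (subtopology Y (f ` U)) f)"

text \<open>Ample groupoid: unit space locally compact Hausdorff totally disconnected
  (in the subspace topology), s and r local homeomorphisms onto the unit space;
  the groupoid itself need not be Hausdorff.\<close>

definition ample_groupoid ::
  "'g topology \<Rightarrow> 'g set \<Rightarrow> ('g \<Rightarrow> 'g) \<Rightarrow> ('g \<Rightarrow> 'g) \<Rightarrow> ('g \<Rightarrow> 'g \<Rightarrow> 'g) \<Rightarrow> ('g \<Rightarrow> 'g) \<Rightarrow> bool" where
  "ample_groupoid T G0 s r m i \<longleftrightarrow>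
     topological_groupoid T G0 s r m i \<and>
     locally_compact_space (subtopology T G0) \<and>
     Hausdorff_space (subtopology T G0) \<and>
     totally_disconnected_space (subtopology T G0) \<and>
     local_homeomorphism T (subtopology T G0) s \<and>
     local_homeomorphism T (subtopology T G0) r"

definition invariant_set :: "'g topology \<Rightarrow> 'g set \<Rightarrow> ('g \<Rightarrow> 'g) \<Rightarrow> ('g \<Rightarrow> 'g) \<Rightarrow> 'g set \<Rightarrow> bool" where
  "invariant_set T G0 s r D \<longleftrightarrow>
     D \<subseteq> G0 \<and> (\<forall>\<gamma> \<in> topspace T. s \<gamma> \<in> D \<longrightarrow> r \<gamma> \<in> D)"

definition minimal_groupoid :: "'g topology \<Rightarrow> 'g set \<Rightarrow> ('g \<Rightarrow> 'g) \<Rightarrow> ('g \<Rightarrow> 'g) \<Rightarrow> bool" where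
  "minimal_groupoid T G0 s r \<longleftrightarrow>
     (\<forall>D. openin (subtopology T G0) D \<and> invariant_set T G0 s r D \<longrightarrow> D = {} \<or> D = G0)"

definition effective_groupoid :: "'g topology \<Rightarrow> 'g set \<Rightarrow> ('g \<Rightarrow> 'g) \<Rightarrow> ('g \<Rightarrow> 'g) \<Rightarrow> bool" where
  "effective_groupoid T G0 s r \<longleftrightarrow>
     T interior_of {\<gamma> \<in> topspace T. s \<gamma> = r \<gamma>} = G0"

definition bisection :: "'g topology \<Rightarrow> ('g \<Rightarrow> 'g) \<Rightarrow> ('g \<Rightarrow> 'g) \<Rightarrow> 'g set \<Rightarrow> bool" where
  "bisection T s r U \<longleftrightarrow>
     U \<subseteq> topspace T \<and>
     homeomorphic_map (subtopology T U) (subtopology T (s ` U)) s \<and>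
     homeomorphic_map (subtopology T U) (subtopology T (r ` U)) r"

definition compact_open_bisection :: "'g topology \<Rightarrow> ('g \<Rightarrow> 'g) \<Rightarrow> ('g \<Rightarrow> 'g) \<Rightarrow> 'g set \<Rightarrow> bool" where
  "compact_open_bisection T s r U \<longleftrightarrow> compactin T U \<and> openin T U \<and> bisection T s r U"

definition semifield :: "'a::comm_semiring_1 itself \<Rightarrow> bool" where
  "semifield _ \<longleftrightarrow> (\<forall>x::'a. x \<noteq> 0 \<longrightarrow> (\<exists>y. x * y = 1))"

definition is_field :: "'a::comm_semiring_1 itself \<Rightarrow> bool" where
  "is_field _ \<longleftrightarrow> semifield TYPE('a) \<and> (\<forall>x::'a. \<exists>y. x + y = 0)"

definition is_boolean_semifield :: "'a::comm_semiring_1 itself \<Rightarrow> bool" where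
  "is_boolean_semifield _ \<longleftrightarrow> (UNIV :: 'a set) = {0, 1} \<and> (1::'a) + 1 = 1"

definition steinberg_algebra ::
  "'g topology \<Rightarrow> ('g \<Rightarrow> 'g) \<Rightarrow> ('g \<Rightarrow> 'g) \<Rightarrow> 'a::comm_semiring_1 itself \<Rightarrow> ('g \<Rightarrow> 'a) set" where
  "steinberg_algebra T s r _ =
     {f. \<exists>F c. finite F \<and> (\<forall>U \<in> F. compact_open_bisection T s r U) \<and>
              f = (\<lambda>\<gamma>. \<Sum>U \<in> F. c U * indicator U \<gamma>)}"

text \<open>Convolution (f * g)(\<gamma>) = sum over all factorizations \<gamma> = \<alpha>\<beta>.
  The sum is taken over the factorizations with nonzero term (finitely many for
  elements of the Steinberg algebra), which equals the full sum.\<close>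
definition convolution ::
  "'g topology \<Rightarrow> ('g \<Rightarrow> 'g) \<Rightarrow> ('g \<Rightarrow> 'g) \<Rightarrow> ('g \<Rightarrow> 'g \<Rightarrow> 'g) \<Rightarrow>
   ('g \<Rightarrow> 'a::comm_semiring_1) \<Rightarrow> ('g \<Rightarrow> 'a) \<Rightarrow> 'g \<Rightarrow> 'a" where
  "convolution T s r m f g \<gamma> =
     (\<Sum>p \<in> {(\<alpha>, \<beta>). \<alpha> \<in> topspace T \<and> \<beta> \<in> topspace T \<and> s \<alpha> = r \<beta> \<and> m \<alpha> \<beta> = \<gamma> \<and>
                     f \<alpha> * g \<beta> \<noteq> 0}. f (fst p) * g (snd p))"

definition hemiring_congruence ::
  "'b set \<Rightarrow> ('b \<Rightarrow> 'b \<Rightarrow> 'b) \<Rightarrow> ('b \<Rightarrow> 'b \<Rightarrow> 'b) \<Rightarrow> ('b \<times> 'b) set \<Rightarrow> bool" where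
  "hemiring_congruence A add mul R \<longleftrightarrow>
     equiv A R \<and>
     (\<forall>x y z. (x, y) \<in> R \<longrightarrow> z \<in> A \<longrightarrow>
        (add x z, add y z) \<in> R \<and> (mul z x, mul z y) \<in> R \<and> (mul x z, mul y z) \<in> R)"

definition congruence_simple ::
  "'b set \<Rightarrow> ('b \<Rightarrow> 'b \<Rightarrow> 'b) \<Rightarrow> ('b \<Rightarrow> 'b \<Rightarrow> 'b) \<Rightarrow> bool" where
  "congruence_simple A add mul \<longleftrightarrow>
     (\<forall>R. hemiring_congruence A add mul R \<longrightarrow> R = A \<times> A \<or> R = Id_on A)"

definition steinberg_congruence_simple ::
  "'g topology \<Rightarrow> ('g \<Rightarrow> 'g) \<Rightarrow> ('g \<Rightarrow> 'g) \<Rightarrow> ('g \<Rightarrow> 'g \<Rightarrow> 'g) \<Rightarrow> 'a::comm_semiring_1 itself \<Rightarrow> bool" where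
  "steinberg_congruence_simple T s r m A \<longleftrightarrow>
     congruence_simple (steinberg_algebra T s r A) (\<lambda>f g \<gamma>. f \<gamma> + g \<gamma>) (convolution T s r m)"

end

theory Submission
  imports Defs
begin

text \<open>
  Necessity comes from four explicit congruences on the Steinberg algebra: equality of supports
  (when \<open>S\<close> is not a field it is zero-sum-free, and collapsing the nonzero values forces \<open>S\<close> to be
  Boolean); equality off the arrows over an open invariant set; equality of the sums over all arrows
  with prescribed source and range; and equality on a dense open set.

  Conversely, two congruent functions that differ on a nonempty open set can be translated so that they
  differ on an open set of units. If the groupoid is effective, that set contains a nonempty compact open
  \<open>K\<close> such that each of the finitely many bisections involved either contains \<open>K\<close> or has no arrow
  from \<open>K\<close> to \<open>K\<close>. Compressing by \<open>1\<^sub>K\<close> makes \<open>a 1\<^sub>K\<close> congruent to \<open>b 1\<^sub>K\<close> with \<open>a \<noteq> b\<close>, hence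
  \<open>1\<^sub>K\<close> congruent to \<open>0\<close>, and minimality spreads this over the whole algebra.
\<close>

subsection \<open>Ample groupoids\<close>

text \<open>The obstacle is that the space of arrows need not be Hausdorff: indicators of compact
  open bisections need not be continuous, so different elements may agree on a dense set. In the
  converse, condition (3) is what turns \<open>f \<noteq> g\<close> into a difference on a nonempty
  open set. Arguments that need compact sets to be closed are moved to the unit space, which is
  Hausdorff. Compatibility with convolution is tested against indicators of compact open bisections.
  Left convolution by such an indicator is a partial translation of arrows: it moves values and
  never adds them. Only addition combines values, which is why equality of supports needs
  coefficients without zero sums. Right convolution is left convolution in the opposite groupoid, so
  each translation argument is given only once.\<close>

lemma local_homeomorphism_imp_continuous_map:
  assumes "local_homeomorphism X Y f"
  shows "continuous_map X Y f"
  unfolding continuous_map_def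
proof (intro conjI allI impI)
  show "f \<in> topspace X \<rightarrow> topspace Y"
    using assms by (auto simp: local_homeomorphism_def)
  fix V assume V: "openin Y V"
  show "openin X {x \<in> topspace X. f x \<in> V}"
  proof (subst openin_subopen, clarify)
    fix x assume x: "x \<in> topspace X" "f x \<in> V"
    then obtain U where U: "openin X U" "x \<in> U"
        "homeomorphic_map (subtopology X U) (subtopology Y (f ` U)) f"
      using assms by (auto simp: local_homeomorphism_def)
    have "openin (subtopology Y (f ` U)) (f ` U \<inter> V)"
      using V by (simp add: openin_subtopology_Int2)
    then have "openin (subtopology X U) {y \<in> topspace (subtopology X U). f y \<in> f ` U \<inter> V}"
      using U(3) homeomorphic_imp_continuous_map openin_continuous_map_preimage by blast
    moreover have "{y \<in> topspace (subtopology X U). f y \<in> f ` U \<inter> V} = {y \<in> U. f y \<in> V}"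
      using openin_subset[OF U(1)] by auto
    ultimately have "openin X {y \<in> U. f y \<in> V}"
      using U(1) openin_trans_full by fastforce
    then show "\<exists>W. openin X W \<and> x \<in> W \<and> W \<subseteq> {x \<in> topspace X. f x \<in> V}"
      using U x openin_subset[OF U(1)] by (intro exI[of _ "{y \<in> U. f y \<in> V}"]) auto
  qed
qed

lemma local_homeomorphism_imp_open_map:
  assumes "local_homeomorphism X Y f"
  shows "open_map X Y f"
  unfolding open_map_def
proof (intro allI impI)
  fix W assume W: "openin X W"
  show "openin Y (f ` W)"
  proof (subst openin_subopen, clarify)
    fix x assume x: "x \<in> W"
    then have "x \<in> topspace X"
      using W openin_subset by blast
    then obtain U where U: "openin X U" "x \<in> U" "openin Y (f ` U)"
        "homeomorphic_map (subtopology X U) (subtopology Y (f ` U)) f"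
      using assms by (auto simp: local_homeomorphism_def)
    have "openin (subtopology X U) (U \<inter> W)"
      using W by (simp add: openin_subtopology_Int2)
    then have "openin (subtopology Y (f ` U)) (f ` (U \<inter> W))"
      using U(4) homeomorphic_imp_open_map open_map_def by blast
    then have "openin Y (f ` (U \<inter> W))"
      using U(3) openin_trans_full by blast
    then show "\<exists>V. openin Y V \<and> f x \<in> V \<and> V \<subseteq> f ` W"
      using U x by blast
  qed
qed

lemma local_homeomorphism_locally_inj:
  assumes "local_homeomorphism X Y f" "x \<in> topspace X"
  obtains U where "openin X U" "x \<in> U" "inj_on f U"
proof -
  obtain U where U: "openin X U" "x \<in> U"
      "homeomorphic_map (subtopology X U) (subtopology Y (f ` U)) f"
    using assms by (auto simp: local_homeomorphism_def)
  have "inj_on f (topspace (subtopology X U))"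
    using U(3) homeomorphic_imp_injective_map by blast
  then show ?thesis
    using that[of U] U openin_subset[OF U(1)] by (simp add: inf.absorb2)
qed

locale ample =
  fixes T :: "'g topology" and G0 :: "'g set" and s r :: "'g \<Rightarrow> 'g"
    and m :: "'g \<Rightarrow> 'g \<Rightarrow> 'g" and i :: "'g \<Rightarrow> 'g"
  assumes ample: "ample_groupoid T G0 s r m i"
begin

abbreviation G where "G \<equiv> topspace T"
abbreviation X where "X \<equiv> subtopology T G0"
abbreviation cob where "cob \<equiv> compact_open_bisection T s r"

lemma groupoid: "groupoid T G0 s r m i"
  using ample by (auto simp: ample_groupoid_def topological_groupoid_def)

lemma
  shows unit_in: "u \<in> G0 \<Longrightarrow> u \<in> G"
    and s_in: "a \<in> G \<Longrightarrow> s a \<in> G0"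
    and r_in: "a \<in> G \<Longrightarrow> r a \<in> G0"
    and s_unit: "u \<in> G0 \<Longrightarrow> s u = u"
    and r_unit: "u \<in> G0 \<Longrightarrow> r u = u"
    and m_in: "\<lbrakk>a \<in> G; b \<in> G; s a = r b\<rbrakk> \<Longrightarrow> m a b \<in> G"
    and s_m: "\<lbrakk>a \<in> G; b \<in> G; s a = r b\<rbrakk> \<Longrightarrow> s (m a b) = s b"
    and r_m: "\<lbrakk>a \<in> G; b \<in> G; s a = r b\<rbrakk> \<Longrightarrow> r (m a b) = r a"
    and m_assoc: "\<lbrakk>a \<in> G; b \<in> G; c \<in> G; s a = r b; s b = r c\<rbrakk> \<Longrightarrow> m (m a b) c = m a (m b c)"
    and m_r: "a \<in> G \<Longrightarrow> m (r a) a = a"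
    and m_s: "a \<in> G \<Longrightarrow> m a (s a) = a"
    and i_in: "a \<in> G \<Longrightarrow> i a \<in> G"
    and s_i: "a \<in> G \<Longrightarrow> s (i a) = r a"
    and r_i: "a \<in> G \<Longrightarrow> r (i a) = s a"
    and m_i_right: "a \<in> G \<Longrightarrow> m a (i a) = r a"
    and m_i_left: "a \<in> G \<Longrightarrow> m (i a) a = s a"
  using groupoid unfolding groupoid_def by blast+

lemmas groupoid_simps = unit_in s_in r_in s_unit r_unit m_in s_m r_m m_r m_s i_in s_i r_i
  m_i_right m_i_left

lemma i_m_cancel: "\<lbrakk>a \<in> G; b \<in> G; s a = r b\<rbrakk> \<Longrightarrow> m (i a) (m a b) = b"
  by (metis m_assoc i_in s_i m_i_left m_r)

lemma m_i_cancel: "\<lbrakk>a \<in> G; c \<in> G; r a = r c\<rbrakk> \<Longrightarrow> m a (m (i a) c) = c"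
  by (metis m_assoc i_in s_i r_i m_i_right m_r)

lemma i_i: "a \<in> G \<Longrightarrow> i (i a) = a"
  using i_m_cancel[of "i a" a] m_s[of "i (i a)"] by (simp add: i_in s_i r_i m_i_left)

text \<open>Reversing all arrows interchanges left and right. Instantiating the locale at the
  opposite groupoid turns a statement on \<open>s\<close>, or on left convolution, into its mirror
  image on \<open>r\<close>, or on right convolution.\<close>

lemma opposite: "ample T G0 r s (\<lambda>a b. m b a) i"
proof
  have 1: "groupoid T G0 r s (\<lambda>a b. m b a) i"
    unfolding groupoid_def
    by (intro conjI ballI impI subsetI) (simp_all add: groupoid_simps m_assoc)
  have cont: "continuous_map (subtopology (prod_topology T T) (composable_pairs T s r)) T (\<lambda>(a, b). m a b)"
    using ample by (auto simp: ample_groupoid_def topological_groupoid_def)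
  have "continuous_map (subtopology (prod_topology T T) (composable_pairs T r s))
          (subtopology (prod_topology T T) (composable_pairs T s r)) prod.swap"
    unfolding prod.swap_def
    by (auto simp: continuous_map_in_subtopology composable_pairs_def continuous_map_pairedI
        continuous_map_from_subtopology continuous_map_fst continuous_map_snd)
  then have "continuous_map (subtopology (prod_topology T T) (composable_pairs T r s)) T
      ((\<lambda>(a, b). m a b) \<circ> prod.swap)"
    using cont by (rule continuous_map_compose)
  moreover have "(\<lambda>(a, b). m a b) \<circ> prod.swap = (\<lambda>(a, b). m b a)"
    by auto
  ultimately show "ample_groupoid T G0 r s (\<lambda>a b. m b a) i"
    using ample 1 by (auto simp: ample_groupoid_def topological_groupoid_def)
qed

section \<open>Topology of the unit space and compact open bisections\<close>

lemma
  shows locally_compact_X: "locally_compact_space X"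
    and Hausdorff_X: "Hausdorff_space X"
    and totally_disconnected_X: "totally_disconnected_space X"
    and local_homeomorphism_s: "local_homeomorphism T X s"
    and local_homeomorphism_r: "local_homeomorphism T X r"
    and continuous_i: "continuous_map T T i"
    and continuous_m: "continuous_map (subtopology (prod_topology T T) (composable_pairs T s r)) T (\<lambda>(a, b). m a b)"
  using ample by (auto simp: ample_groupoid_def topological_groupoid_def)

lemmas continuous_s = local_homeomorphism_imp_continuous_map[OF local_homeomorphism_s]
lemmas continuous_r = local_homeomorphism_imp_continuous_map[OF local_homeomorphism_r]

lemma topspace_X [simp]: "topspace X = G0"
  using unit_in by auto

text \<open>Near a unit choose an open \<open>U\<close> on which \<open>s\<close> is injective. An
  arrow of \<open>U\<close> whose source also lies in \<open>U\<close> has the same image under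
  \<open>s\<close> as that source, so it is equal to it and is a unit.\<close>

lemma open_units: "openin T G0"
proof (subst openin_subopen, clarify)
  fix u assume u: "u \<in> G0"
  obtain U where U: "openin T U" "u \<in> U" "inj_on s U"
    using local_homeomorphism_locally_inj[OF local_homeomorphism_s unit_in[OF u]] by blast
  have "openin T {\<gamma> \<in> U. s \<gamma> \<in> G0 \<inter> U}"
    using U(1) openin_continuous_map_preimage_gen[OF continuous_s, of U "G0 \<inter> U"]
    by (simp add: openin_subtopology_Int2)
  moreover have "\<gamma> \<in> G0" if "\<gamma> \<in> U" "s \<gamma> \<in> U" for \<gamma>
  proof -
    have "\<gamma> \<in> G"
      using that U(1) openin_subset by blast
    then have "s (s \<gamma>) = s \<gamma>"
      by (simp add: s_in s_unit)
    then show ?thesis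
      using U(3) that inj_onD s_in[OF \<open>\<gamma> \<in> G\<close>] by metis
  qed
  ultimately show "\<exists>V. openin T V \<and> u \<in> V \<and> V \<subseteq> G0"
    using u U(2) s_unit by (intro exI[of _ "{\<gamma> \<in> U. s \<gamma> \<in> G0 \<inter> U}"]) auto
qed

lemma openin_X_iff: "openin X U \<longleftrightarrow> openin T U \<and> U \<subseteq> G0"
  by (simp add: open_units openin_open_subtopology)

lemma open_image_s: "openin T U \<Longrightarrow> openin T (s ` U)"
  using local_homeomorphism_imp_open_map[OF local_homeomorphism_s] openin_X_iff
  by (auto simp: open_map_def)

lemma open_preimage_s: "openin T U \<Longrightarrow> openin T V \<Longrightarrow> openin T {\<gamma> \<in> U. s \<gamma> \<in> V}"
proof -
  assume UV: "openin T U" "openin T V"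
  have "openin T {\<gamma> \<in> U. s \<gamma> \<in> G0 \<inter> V}"
    using UV openin_continuous_map_preimage_gen[OF continuous_s, of U "G0 \<inter> V"]
    by (simp add: openin_subtopology_Int2)
  moreover have "{\<gamma> \<in> U. s \<gamma> \<in> G0 \<inter> V} = {\<gamma> \<in> U. s \<gamma> \<in> V}"
    using openin_subset[OF UV(1)] s_in by auto
  ultimately show ?thesis by simp
qed

lemma open_preimage_r: "openin T U \<Longrightarrow> openin T V \<Longrightarrow> openin T {\<gamma> \<in> U. r \<gamma> \<in> V}"
  using ample.open_preimage_s[OF opposite] .

lemma compact_image_s: "compactin T U \<Longrightarrow> compactin T (s ` U)"
  using image_compactin[OF _ continuous_s] compactin_subtopology by blast

text \<open>Components of the unit space are points, and in a locally compact Hausdorff space a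
  compact component has arbitrarily small clopen neighbourhoods. One inside
  \<open>U \<inter> V\<close> is a closed subset of the compact set \<open>L\<close>, hence
  compact.\<close>

lemma compact_open_base:
  assumes "openin T V" "u \<in> V" "u \<in> G0"
  obtains K where "compactin T K" "openin T K" "u \<in> K" "K \<subseteq> V" "K \<subseteq> G0"
proof -
  obtain U L where UL: "openin X U" "compactin X L" "u \<in> U" "U \<subseteq> L"
    using locally_compact_X assms(3) unfolding locally_compact_space_def topspace_X by blast
  have conn: "connected_component_of_set X u = {u}"
    using totally_disconnected_X assms(3) unfolding totally_disconnected_space_def topspace_X by blast
  have "{u} \<in> connected_components_of X"
    unfolding connected_components_of_def using conn assms(3) by (metis imageI topspace_X)
  moreover have "compactin X {u}"
    using assms(3) unit_in by simp
  moreover have "openin X (U \<inter> V)"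
    using UL(1) assms(1) by (auto simp: openin_X_iff)
  ultimately obtain K K' where K: "openin X K" "openin X K'" "disjnt K K'" "K \<union> K' = topspace X"
      "{u} \<subseteq> K" "K \<subseteq> U \<inter> V"
    using wilder_locally_compact_component_thm[OF locally_compact_X Hausdorff_X, of "{u}" "U \<inter> V"]
      UL(3) assms(2) by auto
  have "K = topspace X - K'"
    using K by (auto simp: disjnt_iff)
  then have "closedin X K"
    using K(2) by blast
  then have "compactin X K"
    using closed_compactin[OF UL(2), of K] K UL by blast
  then show ?thesis
    using that[of K] K by (auto simp: openin_X_iff compactin_subtopology)
qed

lemma homeomorphic_map_s:
  assumes "openin T U" "inj_on s U"
  shows "homeomorphic_map (subtopology T U) (subtopology T (s ` U)) s"
proof (rule bijective_open_imp_homeomorphic_map)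
  have U: "U \<subseteq> G"
    using assms openin_subset by blast
  have sU: "s ` U \<subseteq> G"
    using U s_in unit_in by blast
  show "continuous_map (subtopology T U) (subtopology T (s ` U)) s"
    using continuous_s U by (auto simp: continuous_map_in_subtopology continuous_map_from_subtopology)
  show "open_map (subtopology T U) (subtopology T (s ` U)) s"
    using assms open_image_s
    by (auto simp: open_map_def openin_open_subtopology)
  show "s ` topspace (subtopology T U) = topspace (subtopology T (s ` U))"
    using U sU by (simp add: inf.absorb2)
  show "inj_on s (topspace (subtopology T U))"
    using assms by (simp add: inj_on_def)
qed

text \<open>Since \<open>s\<close> and \<open>r\<close> are continuous and open, an injective
  restriction to an open set is automatically a homeomorphism onto its image. This is the working
  form of bisections below.\<close>

lemma cob_iff: "cob U \<longleftrightarrow> compactin T U \<and> openin T U \<and> inj_on s U \<and> inj_on r U"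
proof -
  have "inj_on f U" if "openin T U" "homeomorphic_map (subtopology T U) Y f" for f and Y :: "'g topology"
    using homeomorphic_imp_injective_map[OF that(2)] openin_subset[OF that(1)]
    by (simp add: inf.absorb2)
  note inj = this
  show ?thesis
  proof
    assume "cob U"
    then show "compactin T U \<and> openin T U \<and> inj_on s U \<and> inj_on r U"
      unfolding compact_open_bisection_def bisection_def using inj by meson
  next
    assume U: "compactin T U \<and> openin T U \<and> inj_on s U \<and> inj_on r U"
    then show "cob U"
      unfolding compact_open_bisection_def bisection_def
      using homeomorphic_map_s[of U] ample.homeomorphic_map_s[OF opposite, of U] openin_subset[of T U]
      by simp
  qed
qed

lemma cob_opposite: "compact_open_bisection T r s U \<longleftrightarrow> cob U"
  by (auto simp: compact_open_bisection_def bisection_def)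

lemma cob_subset: "cob U \<Longrightarrow> U \<subseteq> G"
  by (simp add: compact_open_bisection_def bisection_def)

lemma cob_unit: "\<lbrakk>compactin T K; openin T K; K \<subseteq> G0\<rbrakk> \<Longrightarrow> cob K"
  unfolding cob_iff using s_unit r_unit by (auto intro!: inj_onI simp: subset_iff)

text \<open>Compact sets of arrows need not be closed in \<open>T\<close>; their images in the
  Hausdorff unit space are.\<close>

lemma closed_image_s:
  assumes "compactin T B"
  shows "closedin X (s ` B)"
  using assms Hausdorff_X compactin_imp_closedin image_compactin continuous_s by blast

text \<open>Shrink \<open>V\<close> until \<open>s\<close> and \<open>r\<close> are both injective,
  then pull a compact open set of units back along the homeomorphism \<open>s\<close>.\<close>

lemma cob_base:
  assumes "openin T V" "\<gamma> \<in> V"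
  obtains B where "cob B" "\<gamma> \<in> B" "B \<subseteq> V"
proof -
  have \<gamma>: "\<gamma> \<in> G"
    using assms openin_subset by blast
  obtain U1 where U1: "openin T U1" "\<gamma> \<in> U1" "inj_on s U1"
    using local_homeomorphism_locally_inj[OF local_homeomorphism_s \<gamma>] by blast
  obtain U2 where U2: "openin T U2" "\<gamma> \<in> U2" "inj_on r U2"
    using local_homeomorphism_locally_inj[OF local_homeomorphism_r \<gamma>] by blast
  define U where "U = U1 \<inter> U2 \<inter> V"
  have U: "openin T U" "\<gamma> \<in> U" "inj_on s U" "inj_on r U" "U \<subseteq> V"
    using U1 U2 assms by (auto simp: U_def inj_on_def)
  obtain K where K: "compactin T K" "openin T K" "s \<gamma> \<in> K" "K \<subseteq> s ` U" "K \<subseteq> G0"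
    using compact_open_base[OF open_image_s[OF U(1)], of "s \<gamma>"] U(2) s_in[OF \<gamma>] by blast
  define B where "B = {\<beta> \<in> U. s \<beta> \<in> K}"
  have hom: "homeomorphic_map (subtopology T U) (subtopology T (s ` U)) s"
    using homeomorphic_map_s U by blast
  have sB: "s ` B = K"
    using K by (auto simp: B_def)
  have "compactin (subtopology T (s ` U)) (s ` B)"
    using K sB by (simp add: compactin_subtopology)
  then have "compactin (subtopology T U) B"
    using homeomorphic_map_compactness[OF hom, of B] U(1) openin_subset by (force simp: B_def)
  then have "compactin T B"
    by (simp add: compactin_subtopology)
  moreover have "openin T B"
    using open_preimage_s[OF U(1) K(2)] by (simp add: B_def)
  ultimately have "cob B"
    using U by (auto simp: cob_iff B_def inj_on_def)
  then show ?thesis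
    using that[of B] U K by (auto simp: B_def)
qed

lemma cob_inverse:
  assumes "cob B"
  shows "cob (i ` B)"
proof -
  have B: "B \<subseteq> G" "compactin T B" "openin T B" "inj_on s B" "inj_on r B"
    using assms cob_subset cob_iff by auto
  \<comment> \<open>Inversion is an involution, so the image is also a preimage and its openness
    follows from continuity of \<open>i\<close>.\<close>
  have "i ` B = {\<gamma> \<in> G. i \<gamma> \<in> B}"
  proof safe
    fix \<gamma> assume "\<gamma> \<in> G" "i \<gamma> \<in> B"
    then show "\<gamma> \<in> i ` B"
      using i_i by (metis imageI)
  qed (use B i_in i_i in \<open>auto simp: subset_iff\<close>)
  then have "openin T (i ` B)"
    using openin_continuous_map_preimage[OF continuous_i B(3)] by simp
  moreover have "compactin T (i ` B)"
    using image_compactin[OF B(2) continuous_i] .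
  moreover have "inj_on s (i ` B)" "inj_on r (i ` B)"
    using B s_i r_i by (auto simp: inj_on_def subset_iff)
  ultimately show ?thesis
    by (simp add: cob_iff)
qed

section \<open>Products and translations of bisections\<close>

definition set_mult :: "'g set \<Rightarrow> 'g set \<Rightarrow> 'g set" where
  "set_mult B C = {m b c | b c. b \<in> B \<and> c \<in> C \<and> s b = r c}"

text \<open>As \<open>s\<close> is injective on \<open>B\<close>, exactly one arrow of
  \<open>B\<close> is composable with a given \<gamma> whose range lies in \<open>s(B)\<close>. Left
  multiplication by \<open>B\<close> is therefore a map, built from \<open>r\<close>, the inverse of
  \<open>s\<close> on \<open>B\<close>, and the groupoid multiplication.\<close>

lemma continuous_translation:
  assumes "cob B"
  shows "continuous_map (subtopology T {\<gamma> \<in> G. r \<gamma> \<in> s ` B}) T (\<lambda>\<gamma>. m (inv_into B s (r \<gamma>)) \<gamma>)"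
proof -
  have B: "B \<subseteq> G" "openin T B" "inj_on s B"
    using assms cob_subset cob_iff by auto
  let ?D = "{\<gamma> \<in> G. r \<gamma> \<in> s ` B}"
  have "homeomorphic_map (subtopology T B) (subtopology T (s ` B)) s"
    using homeomorphic_map_s B by blast
  then obtain g where g: "continuous_map (subtopology T (s ` B)) (subtopology T B) g"
      "\<And>x. x \<in> B \<Longrightarrow> g (s x) = x"
    using B by (auto simp: homeomorphic_map_maps homeomorphic_maps_def subset_iff)
  have "continuous_map (subtopology T ?D) (subtopology T (s ` B)) r"
    using continuous_r by (auto simp: continuous_map_in_subtopology continuous_map_from_subtopology)
  then have "continuous_map (subtopology T ?D) (subtopology T B) (g \<circ> r)"
    using g(1) by (rule continuous_map_compose)
  then have "continuous_map (subtopology T ?D) T (g \<circ> r)"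
    using continuous_map_in_subtopology by blast
  then have "continuous_map (subtopology T ?D) (prod_topology T T) (\<lambda>\<gamma>. ((g \<circ> r) \<gamma>, \<gamma>))"
    using continuous_map_from_subtopology[OF continuous_map_id[unfolded id_def]]
    by (intro continuous_map_pairedI)
  moreover have "((g \<circ> r) \<gamma>, \<gamma>) \<in> composable_pairs T s r" if "\<gamma> \<in> ?D" for \<gamma>
    using that B(1) g(2) by (auto simp: composable_pairs_def subset_iff)
  ultimately have "continuous_map (subtopology T ?D)
      (subtopology (prod_topology T T) (composable_pairs T s r)) (\<lambda>\<gamma>. ((g \<circ> r) \<gamma>, \<gamma>))"
    by (auto simp: continuous_map_in_subtopology)
  then have "continuous_map (subtopology T ?D) T ((\<lambda>(a, b). m a b) \<circ> (\<lambda>\<gamma>. ((g \<circ> r) \<gamma>, \<gamma>)))"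
    using continuous_m by (rule continuous_map_compose)
  then show ?thesis
    by (rule continuous_map_eq) (use g(2) B(3) in auto)
qed

text \<open>An arrow has the form \<open>m b v\<close> exactly when its translate by the inverse
  bisection lands in \<open>V\<close>, so the product is a preimage of \<open>V\<close> under a
  continuous map with open domain.\<close>

lemma open_set_mult:
  assumes B: "cob B" and V: "openin T V"
  shows "openin T (set_mult B V)"
proof -
  have BG: "B \<subseteq> G" "inj_on r B"
    using B cob_subset cob_iff by auto
  have VG: "V \<subseteq> G"
    using V openin_subset by blast
  let ?D = "{\<gamma> \<in> G. r \<gamma> \<in> s ` (i ` B)}"
  let ?\<phi> = "\<lambda>\<gamma>. m (inv_into (i ` B) s (r \<gamma>)) \<gamma>"
  have inj: "inj_on s (i ` B)"
    using cob_inverse[OF B] cob_iff by auto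
  have \<phi>: "?\<phi> \<gamma> = m (i b) \<gamma>" if "b \<in> B" "r b = r \<gamma>" for b \<gamma>
  proof -
    have "s (i b) = r \<gamma>"
      using that BG s_i by (auto simp: subset_iff)
    then show ?thesis
      using inv_into_f_f[OF inj, of "i b"] that by auto
  qed
  have "openin T (s ` (i ` B))"
    using cob_inverse[OF B] cob_iff open_image_s by blast
  then have D: "openin T ?D"
    using open_preimage_r[OF openin_topspace] by blast
  have "openin (subtopology T ?D) {\<gamma> \<in> topspace (subtopology T ?D). ?\<phi> \<gamma> \<in> V}"
    by (rule openin_continuous_map_preimage[OF continuous_translation[OF cob_inverse[OF B]] V])
  then have "openin T {\<gamma> \<in> topspace (subtopology T ?D). ?\<phi> \<gamma> \<in> V}"
    using D openin_trans_full by blast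
  moreover have "{\<gamma> \<in> topspace (subtopology T ?D). ?\<phi> \<gamma> \<in> V} = set_mult B V"
  proof (intro equalityI subsetI)
    fix \<gamma> assume "\<gamma> \<in> {\<gamma> \<in> topspace (subtopology T ?D). ?\<phi> \<gamma> \<in> V}"
    then obtain b where b: "\<gamma> \<in> G" "b \<in> B" "r \<gamma> = s (i b)" "?\<phi> \<gamma> \<in> V"
      by auto
    then have "r b = r \<gamma>" "b \<in> G"
      using BG s_i by (auto simp: subset_iff)
    then have "m (i b) \<gamma> \<in> V" "\<gamma> = m b (m (i b) \<gamma>)" "s b = r (m (i b) \<gamma>)"
      using \<phi>[of b \<gamma>] b m_i_cancel[of b \<gamma>] i_in s_i r_i r_m[of "i b" \<gamma>] by auto
    then show "\<gamma> \<in> set_mult B V"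
      unfolding set_mult_def using b(2) by blast
  next
    fix \<gamma> assume "\<gamma> \<in> set_mult B V"
    then obtain b v where bv: "\<gamma> = m b v" "b \<in> B" "v \<in> V" "s b = r v"
      by (auto simp: set_mult_def)
    then have in_G: "b \<in> G" "v \<in> G"
      using BG VG by auto
    then have "r \<gamma> = r b" "\<gamma> \<in> G"
      using bv r_m m_in by auto
    moreover have "?\<phi> \<gamma> = v"
      using \<phi>[of b \<gamma>] bv in_G \<open>r \<gamma> = r b\<close> i_m_cancel by auto
    moreover have "r \<gamma> \<in> s ` i ` B"
      using \<open>r \<gamma> = r b\<close> in_G bv(2) s_i by (metis imageI)
    ultimately show "\<gamma> \<in> {\<gamma> \<in> topspace (subtopology T ?D). ?\<phi> \<gamma> \<in> V}"
      using bv by simp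
  qed
  ultimately show ?thesis by simp
qed

text \<open>Compactness is the delicate point. The part of \<open>C\<close> composable with
  \<open>B\<close> is cut out by the preimage of \<open>s(B)\<close> under \<open>r\<close>, closed
  because \<open>s(B)\<close> is closed in the unit space; the product is the image of this compact
  part under translation by \<open>B\<close>.\<close>

lemma cob_set_mult:
  assumes B: "cob B" and C: "cob C"
  shows "cob (set_mult B C)"
proof -
  have BC: "B \<subseteq> G" "C \<subseteq> G" "inj_on s B" "inj_on r B" "inj_on s C" "inj_on r C" "openin T C"
      "compactin T B" "compactin T C"
    using B C cob_subset cob_iff by auto
  have "closedin T {\<gamma> \<in> G. r \<gamma> \<in> s ` B}"
    using closedin_continuous_map_preimage[OF continuous_r closed_image_s] BC by blast
  then have "compactin T ({\<gamma> \<in> G. r \<gamma> \<in> s ` B} \<inter> C)"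
    using BC closed_Int_compactin by blast
  then have "compactin (subtopology T {\<gamma> \<in> G. r \<gamma> \<in> s ` B}) ({\<gamma> \<in> G. r \<gamma> \<in> s ` B} \<inter> C)"
    by (simp add: compactin_subtopology)
  then have "compactin T ((\<lambda>\<gamma>. m (inv_into B s (r \<gamma>)) \<gamma>) ` ({\<gamma> \<in> G. r \<gamma> \<in> s ` B} \<inter> C))"
    using continuous_translation[OF B] image_compactin by blast
  moreover have "(\<lambda>\<gamma>. m (inv_into B s (r \<gamma>)) \<gamma>) ` ({\<gamma> \<in> G. r \<gamma> \<in> s ` B} \<inter> C) = set_mult B C"
  proof (intro equalityI subsetI)
    fix \<gamma> assume "\<gamma> \<in> set_mult B C"
    then obtain b c where bc: "\<gamma> = m b c" "b \<in> B" "c \<in> C" "s b = r c"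
      by (auto simp: set_mult_def)
    have "inv_into B s (r c) = b"
      using bc BC(3) inv_into_f_f by metis
    then show "\<gamma> \<in> (\<lambda>\<gamma>. m (inv_into B s (r \<gamma>)) \<gamma>) ` ({\<gamma> \<in> G. r \<gamma> \<in> s ` B} \<inter> C)"
      using bc BC by (intro image_eqI[of _ _ c]) (auto intro: sym image_eqI)
  next
    fix \<gamma> assume "\<gamma> \<in> (\<lambda>\<gamma>. m (inv_into B s (r \<gamma>)) \<gamma>) ` ({\<gamma> \<in> G. r \<gamma> \<in> s ` B} \<inter> C)"
    then obtain b c where "b \<in> B" "c \<in> C" "r c = s b" "\<gamma> = m b c"
      using BC(3) inv_into_f_f by fastforce
    then show "\<gamma> \<in> set_mult B C"
      unfolding set_mult_def by force
  qed
  ultimately have "compactin T (set_mult B C)"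
    by simp
  moreover have "inj_on s (set_mult B C)"
  proof (rule inj_onI)
    fix x y assume "x \<in> set_mult B C" "y \<in> set_mult B C" "s x = s y"
    then obtain b c b' c' where *: "x = m b c" "b \<in> B" "c \<in> C" "s b = r c"
        "y = m b' c'" "b' \<in> B" "c' \<in> C" "s b' = r c'"
      by (auto simp: set_mult_def)
    then have "s c = s c'"
      using \<open>s x = s y\<close> BC s_m by (metis subsetD)
    then have "c = c'"
      using * BC inj_onD by metis
    then show "x = y"
      using * BC inj_onD by metis
  qed
  moreover have "inj_on r (set_mult B C)"
  proof (rule inj_onI)
    fix x y assume "x \<in> set_mult B C" "y \<in> set_mult B C" "r x = r y"
    then obtain b c b' c' where *: "x = m b c" "b \<in> B" "c \<in> C" "s b = r c"
        "y = m b' c'" "b' \<in> B" "c' \<in> C" "s b' = r c'"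
      by (auto simp: set_mult_def)
    then have "r b = r b'"
      using \<open>r x = r y\<close> BC r_m by (metis subsetD)
    then have "b = b'"
      using * BC inj_onD by metis
    then show "x = y"
      using * BC inj_onD by metis
  qed
  ultimately show ?thesis
    using open_set_mult[OF B BC(7)] by (simp add: cob_iff)
qed

subsection \<open>Convolution\<close>

abbreviation conv :: "('g \<Rightarrow> 'a::comm_semiring_1) \<Rightarrow> ('g \<Rightarrow> 'a) \<Rightarrow> 'g \<Rightarrow> 'a" where
  "conv \<equiv> convolution T s r m"

lemma conv_opposite:
  fixes f g :: "'g \<Rightarrow> 'a::comm_semiring_1"
  shows "convolution T r s (\<lambda>a b. m b a) f g = conv g f"
proof
  fix \<gamma>
  show "convolution T r s (\<lambda>a b. m b a) f g \<gamma> = conv g f \<gamma>"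
    unfolding convolution_def
    by (rule sum.reindex_bij_witness[of _ prod.swap prod.swap]) (auto simp: mult.commute)
qed

lemma conv_outside:
  fixes f g :: "'g \<Rightarrow> 'a::comm_semiring_1"
  assumes "\<gamma> \<notin> G"
  shows "conv f g \<gamma> = 0"
proof -
  have "{(\<alpha>, \<beta>). \<alpha> \<in> G \<and> \<beta> \<in> G \<and> s \<alpha> = r \<beta> \<and> m \<alpha> \<beta> = \<gamma> \<and> f \<alpha> * g \<beta> \<noteq> 0} = {}"
    using assms m_in by auto
  then have "(\<Sum>p\<in>{(\<alpha>, \<beta>). \<alpha> \<in> G \<and> \<beta> \<in> G \<and> s \<alpha> = r \<beta> \<and> m \<alpha> \<beta> = \<gamma> \<and> f \<alpha> * g \<beta> \<noteq> 0}.
      f (fst p) * g (snd p)) = 0"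
    by (simp only: sum.empty)
  then show ?thesis
    unfolding convolution_def .
qed

text \<open>The factorizations of \<open>\<gamma>\<close> are parametrized by their left factor.\<close>

lemma conv_eq_sum:
  fixes f g :: "'g \<Rightarrow> 'a::comm_semiring_1"
  assumes \<gamma>: "\<gamma> \<in> G" and P: "finite P" "P \<subseteq> {\<alpha> \<in> G. r \<alpha> = r \<gamma>}"
    and supp: "\<And>\<alpha>. \<lbrakk>\<alpha> \<in> G; r \<alpha> = r \<gamma>; f \<alpha> \<noteq> 0\<rbrakk> \<Longrightarrow> \<alpha> \<in> P"
  shows "conv f g \<gamma> = (\<Sum>\<alpha>\<in>P. f \<alpha> * g (m (i \<alpha>) \<gamma>))"
proof -
  let ?P = "{\<alpha> \<in> P. f \<alpha> * g (m (i \<alpha>) \<gamma>) \<noteq> 0}"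
  have left: "r \<alpha> = r \<gamma>" "m (i \<alpha>) \<gamma> = \<beta>"
    if "\<alpha> \<in> G" "\<beta> \<in> G" "s \<alpha> = r \<beta>" "m \<alpha> \<beta> = \<gamma>" for \<alpha> \<beta>
    using that r_m i_m_cancel by auto
  have right: "m (i \<alpha>) \<gamma> \<in> G" "s \<alpha> = r (m (i \<alpha>) \<gamma>)" "m \<alpha> (m (i \<alpha>) \<gamma>) = \<gamma>" if "\<alpha> \<in> P" for \<alpha>
    using that P(2) \<gamma> m_in i_in s_i r_i r_m m_i_cancel by (auto simp: subset_iff)
  have "conv f g \<gamma> = (\<Sum>\<alpha>\<in>?P. f \<alpha> * g (m (i \<alpha>) \<gamma>))"
    unfolding convolution_def
  proof (rule sum.reindex_bij_witness[of _ "\<lambda>\<alpha>. (\<alpha>, m (i \<alpha>) \<gamma>)" fst], goal_cases)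
    case (2 p)
    obtain \<alpha> \<beta> where p: "p = (\<alpha>, \<beta>)" by (cases p)
    with 2 have *: "\<alpha> \<in> G" "\<beta> \<in> G" "s \<alpha> = r \<beta>" "m \<alpha> \<beta> = \<gamma>" "f \<alpha> * g \<beta> \<noteq> 0"
      by auto
    then have "f \<alpha> \<noteq> 0"
      by auto
    then show ?case
      using left[OF *(1-4)] supp * p by simp
  next
    case (4 \<alpha>)
    then show ?case using right[of \<alpha>] P(2) by auto
  qed (use left(2) in force)+
  also have "\<dots> = (\<Sum>\<alpha>\<in>P. f \<alpha> * g (m (i \<alpha>) \<gamma>))"
    by (rule sum.mono_neutral_left) (use P in auto)
  finally show ?thesis .
qed

text \<open>A bisection contains at most one arrow of each range. Supports of elements of the
  algebra therefore meet each range fibre in a finite set.\<close>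

lemma fiber_finite:
  assumes "finite F" "\<forall>U\<in>F. cob U"
  shows "finite {\<alpha> \<in> \<Union>F. r \<alpha> = v}"
proof -
  have "finite {\<alpha> \<in> U. r \<alpha> = v}" if "U \<in> F" for U
  proof -
    have "inj_on r U"
      using assms(2) that cob_iff by auto
    then have "inj_on r {\<alpha> \<in> U. r \<alpha> = v}"
      by (auto simp: inj_on_def)
    moreover have "r ` {\<alpha> \<in> U. r \<alpha> = v} \<subseteq> {v}"
      by auto
    ultimately show ?thesis
      by (meson finite.emptyI finite_insert inj_on_finite)
  qed
  moreover have "{\<alpha> \<in> \<Union>F. r \<alpha> = v} = (\<Union>U\<in>F. {\<alpha> \<in> U. r \<alpha> = v})"
    by auto
  ultimately show ?thesis
    using assms(1) by simp
qed

lemma combination_support: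
  fixes c :: "'g set \<Rightarrow> 'a::comm_semiring_1"
  assumes "(\<Sum>U\<in>F. c U * indicator U \<gamma>) \<noteq> 0"
  shows "\<gamma> \<in> \<Union>F"
proof -
  obtain U where "U \<in> F" "c U * indicator U \<gamma> \<noteq> 0"
    using assms by (meson sum.neutral)
  then show ?thesis
    by (cases "\<gamma> \<in> U") auto
qed

lemma conv_sum_left:
  fixes g :: "'g \<Rightarrow> 'a::comm_semiring_1"
  assumes F: "finite F" "\<forall>U\<in>F. cob U"
  shows "conv (\<lambda>\<gamma>. \<Sum>U\<in>F. c U * indicator U \<gamma>) g = (\<lambda>\<gamma>. \<Sum>U\<in>F. c U * conv (indicator U) g \<gamma>)"
proof
  fix \<gamma>
  show "conv (\<lambda>\<gamma>. \<Sum>U\<in>F. c U * indicator U \<gamma>) g \<gamma> = (\<Sum>U\<in>F. c U * conv (indicator U) g \<gamma>)"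
  proof (cases "\<gamma> \<in> G")
    case True
    \<comment> \<open>One finite index set serves the combination and all the indicators at once,
      which is what allows the two sums to be interchanged.\<close>
    define P where "P = {\<alpha> \<in> \<Union>F. r \<alpha> = r \<gamma>}"
    have P: "finite P" "P \<subseteq> {\<alpha> \<in> G. r \<alpha> = r \<gamma>}"
      using fiber_finite[OF F] F(2) cob_subset by (auto simp: P_def)
    have U: "conv (indicator U) g \<gamma> = (\<Sum>\<alpha>\<in>P. indicator U \<alpha> * g (m (i \<alpha>) \<gamma>))" if "U \<in> F" for U
      by (rule conv_eq_sum[OF True P]) (use that in \<open>auto simp: P_def indicator_def split: if_splits\<close>)
    have "conv (\<lambda>\<gamma>. \<Sum>U\<in>F. c U * indicator U \<gamma>) g \<gamma>
        = (\<Sum>\<alpha>\<in>P. (\<Sum>U\<in>F. c U * indicator U \<alpha>) * g (m (i \<alpha>) \<gamma>))"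
    proof (rule conv_eq_sum[OF True P])
      fix \<alpha> assume "r \<alpha> = r \<gamma>" "(\<Sum>U\<in>F. c U * indicator U \<alpha>) \<noteq> 0"
      then show "\<alpha> \<in> P"
        using combination_support by (auto simp: P_def)
    qed
    also have "\<dots> = (\<Sum>U\<in>F. \<Sum>\<alpha>\<in>P. c U * (indicator U \<alpha> * g (m (i \<alpha>) \<gamma>)))"
      unfolding sum_distrib_right by (subst sum.swap) (simp add: mult.assoc)
    also have "\<dots> = (\<Sum>U\<in>F. c U * conv (indicator U) g \<gamma>)"
      using U by (simp add: sum_distrib_left)
    finally show ?thesis .
  next
    case False
    then show ?thesis by (simp add: conv_outside)
  qed
qed

lemma conv_sum_right:
  fixes f :: "'g \<Rightarrow> 'a::comm_semiring_1"
  assumes F: "finite F" "\<forall>U\<in>F. cob U"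
  shows "conv f (\<lambda>\<gamma>. \<Sum>U\<in>F. c U * indicator U \<gamma>) = (\<lambda>\<gamma>. \<Sum>U\<in>F. c U * conv f (indicator U) \<gamma>)"
  using ample.conv_sum_left[OF opposite F(1), of c f] F(2)
  by (simp add: conv_opposite cob_opposite)

text \<open>Only \<open>b\<close> contributes: \<open>r\<close> is injective on \<open>B\<close>, so
  no other arrow of \<open>B\<close> can be the left factor of \<open>m b \<delta>\<close>.\<close>

lemma conv_indicator_left:
  fixes f :: "'g \<Rightarrow> 'a::comm_semiring_1"
  assumes B: "cob B" and b: "b \<in> B" and \<delta>: "\<delta> \<in> G" "s b = r \<delta>"
  shows "conv (indicator B) f (m b \<delta>) = f \<delta>"
proof -
  have BG: "B \<subseteq> G" "inj_on r B"
    using B cob_subset cob_iff by auto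
  have "b \<in> G"
    using b BG by auto
  have "conv (indicator B) f (m b \<delta>) = (\<Sum>\<alpha>\<in>{b}. indicator B \<alpha> * f (m (i \<alpha>) (m b \<delta>)))"
  proof (rule conv_eq_sum)
    show "\<alpha> \<in> {b}" if "\<alpha> \<in> G" "r \<alpha> = r (m b \<delta>)" "indicator B \<alpha> \<noteq> (0::'a)" for \<alpha>
      using that BG b r_m[OF \<open>b \<in> G\<close> \<delta>] by (auto simp: indicator_def inj_on_def split: if_splits)
  qed (use \<open>b \<in> G\<close> \<delta> m_in r_m in auto)
  then show ?thesis
    using b \<delta> \<open>b \<in> G\<close> i_m_cancel by simp
qed

lemma conv_indicator_left_zero:
  fixes f :: "'g \<Rightarrow> 'a::comm_semiring_1"
  assumes "r \<gamma> \<notin> r ` B"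
  shows "conv (indicator B) f \<gamma> = 0"
proof (cases "\<gamma> \<in> G")
  case True
  have "conv (indicator B) f \<gamma> = (\<Sum>\<alpha>\<in>{}. indicator B \<alpha> * f (m (i \<alpha>) \<gamma>))"
    by (rule conv_eq_sum[OF True]) (use assms in \<open>auto simp: indicator_def image_iff split: if_splits\<close>)
  then show ?thesis by simp
qed (simp add: conv_outside)

text \<open>The point is the quantifier over \<open>f\<close> in both cases: the arrow \<delta> at
  which \<open>f\<close> is read depends only on \<open>B\<close> and \<gamma>. Two translated
  functions can thus be compared at one and the same arrow.\<close>

lemma conv_indicator_cases:
  fixes f :: "'g \<Rightarrow> 'a::comm_semiring_1"
  assumes B: "cob B"
  obtains (zero) "\<And>f::'g \<Rightarrow> 'a. conv (indicator B) f \<gamma> = 0"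
  | (translate) b \<delta> where "b \<in> B" "\<delta> \<in> G" "s b = r \<delta>" "\<gamma> = m b \<delta>" "r \<gamma> = r b" "s \<gamma> = s \<delta>"
      "\<And>f::'g \<Rightarrow> 'a. conv (indicator B) f \<gamma> = f \<delta>"
proof (cases "\<gamma> \<in> G \<and> r \<gamma> \<in> r ` B")
  case True
  then obtain b where b: "b \<in> B" "r \<gamma> = r b" "\<gamma> \<in> G" "b \<in> G"
    using cob_subset[OF B] by auto
  have \<delta>: "m (i b) \<gamma> \<in> G" "s b = r (m (i b) \<gamma>)" "\<gamma> = m b (m (i b) \<gamma>)" "s \<gamma> = s (m (i b) \<gamma>)"
    using b by (simp_all add: m_in i_in s_i r_i r_m s_m m_i_cancel)
  show ?thesis
  proof (rule translate[OF b(1) \<delta>(1-3) b(2) \<delta>(4)])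
    show "conv (indicator B) f \<gamma> = f (m (i b) \<gamma>)" for f :: "'g \<Rightarrow> 'a"
      using conv_indicator_left[OF B b(1) \<delta>(1,2)] \<delta>(3) by simp
  qed
next
  case False
  then show ?thesis
    using zero conv_outside conv_indicator_left_zero by blast
qed

lemma conv_indicator_unit_left:
  fixes f :: "'g \<Rightarrow> 'a::comm_semiring_1"
  assumes "cob K" "K \<subseteq> G0"
  shows "conv (indicator K) f \<gamma> = (if \<gamma> \<in> G \<and> r \<gamma> \<in> K then f \<gamma> else 0)"
proof (cases "\<gamma> \<in> G \<and> r \<gamma> \<in> K")
  case True
  then show ?thesis
    using conv_indicator_left[OF assms(1), of "r \<gamma>" \<gamma> f] r_in s_unit m_r by simp
next
  case False
  moreover have "r ` K = K"
    using assms(2) r_unit by force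
  ultimately show ?thesis
    using conv_outside conv_indicator_left_zero by metis
qed

lemma conv_indicator_unit_right:
  fixes f :: "'g \<Rightarrow> 'a::comm_semiring_1"
  assumes "cob K" "K \<subseteq> G0"
  shows "conv f (indicator K) \<gamma> = (if \<gamma> \<in> G \<and> s \<gamma> \<in> K then f \<gamma> else 0)"
  using ample.conv_indicator_unit_left[OF opposite, of K f \<gamma>] assms
  by (simp add: conv_opposite cob_opposite)

lemma conv_indicator_indicator:
  assumes "cob B" "cob C"
  shows "conv (indicator B) (indicator C) = (indicator (set_mult B C) :: 'g \<Rightarrow> 'a::comm_semiring_1)"
proof
  fix \<gamma>
  have BC: "B \<subseteq> G" "C \<subseteq> G" "inj_on r B"
    using assms cob_subset cob_iff by auto
  show "conv (indicator B) (indicator C) \<gamma> = (indicator (set_mult B C) \<gamma> :: 'a)"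
  proof (cases "\<gamma> \<in> set_mult B C")
    case True
    then obtain b c where bc: "b \<in> B" "c \<in> C" "s b = r c" "\<gamma> = m b c"
      by (auto simp: set_mult_def)
    then have "conv (indicator B) (indicator C) \<gamma> = (indicator C c :: 'a)"
      using conv_indicator_left[OF assms(1)] BC by blast
    then show ?thesis
      using bc True by simp
  next
    case False
    show ?thesis
      using assms(1)
    proof (cases rule: conv_indicator_cases[where \<gamma>=\<gamma> and 'a='a])
      case zero
      then show ?thesis using False by simp
    next
      case (translate b \<delta>)
      then have "\<delta> \<notin> C"
        using False by (auto simp: set_mult_def)
      then show ?thesis
        using translate False by simp
    qed
  qed
qed

subsection \<open>The Steinberg algebra and its congruences\<close>

abbreviation steinberg :: "('g \<Rightarrow> 'a::comm_semiring_1) set" where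
  "steinberg \<equiv> steinberg_algebra T s r TYPE('a)"

lemma steinbergI:
  "\<lbrakk>finite F; \<forall>U\<in>F. cob U; \<And>\<gamma>. f \<gamma> = (\<Sum>U\<in>F. c U * indicator U \<gamma>)\<rbrakk> \<Longrightarrow> f \<in> steinberg"
  unfolding steinberg_algebra_def by blast

lemma steinbergE:
  assumes "f \<in> steinberg"
  obtains F c where "finite F" "\<forall>U\<in>F. cob U" "f = (\<lambda>\<gamma>. \<Sum>U\<in>F. c U * indicator U \<gamma>)"
  using assms unfolding steinberg_algebra_def by blast

lemma steinberg_zero: "(\<lambda>\<gamma>. 0) \<in> steinberg"
  by (rule steinbergI[of "{}"]) auto

lemma steinberg_indicator: "cob U \<Longrightarrow> (\<lambda>\<gamma>. c * indicator U \<gamma>) \<in> steinberg"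
  by (rule steinbergI[of "{U}" _ "\<lambda>_. c"]) (auto simp del: sum_mult_indicator)

lemma steinberg_indicator1: "cob U \<Longrightarrow> indicator U \<in> steinberg"
  by (rule steinbergI[of "{U}" _ "\<lambda>_. 1"]) (auto simp del: sum_mult_indicator)

lemma steinberg_scale:
  assumes "f \<in> steinberg"
  shows "(\<lambda>\<gamma>. c * f \<gamma>) \<in> steinberg"
proof -
  obtain F d where F: "finite F" "\<forall>U\<in>F. cob U" "f = (\<lambda>\<gamma>. \<Sum>U\<in>F. d U * indicator U \<gamma>)"
    using assms by (rule steinbergE)
  show ?thesis
    by (rule steinbergI[OF F(1,2), of _ "\<lambda>U. c * d U"]) (simp_all add: F(3) sum_distrib_left mult.assoc)
qed

text \<open>Coefficients extended by zero put both functions over one family, so that a single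
  refinement against that family treats both.\<close>

lemma steinberg_common:
  assumes "f \<in> steinberg" "g \<in> steinberg"
  obtains F c d where "finite F" "\<forall>U\<in>F. cob U"
    "f = (\<lambda>\<gamma>. \<Sum>U\<in>F. c U * indicator U \<gamma>)" "g = (\<lambda>\<gamma>. \<Sum>U\<in>F. d U * indicator U \<gamma>)"
proof -
  obtain F c where F: "finite F" "\<forall>U\<in>F. cob U" "f = (\<lambda>\<gamma>. \<Sum>U\<in>F. c U * indicator U \<gamma>)"
    using assms(1) by (rule steinbergE)
  obtain F' d where F': "finite F'" "\<forall>U\<in>F'. cob U" "g = (\<lambda>\<gamma>. \<Sum>U\<in>F'. d U * indicator U \<gamma>)"
    using assms(2) by (rule steinbergE)
  have "f = (\<lambda>\<gamma>. \<Sum>U\<in>F \<union> F'. (if U \<in> F then c U else 0) * indicator U \<gamma>)"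
    unfolding F(3) by (intro ext sum.mono_neutral_cong_left) (use F F' in auto)
  moreover have "g = (\<lambda>\<gamma>. \<Sum>U\<in>F \<union> F'. (if U \<in> F' then d U else 0) * indicator U \<gamma>)"
    unfolding F'(3) by (intro ext sum.mono_neutral_cong_left) (use F F' in auto)
  ultimately show ?thesis
    using F F' by (intro that[of "F \<union> F'"]) auto
qed

lemma steinberg_add:
  assumes "f \<in> steinberg" "g \<in> steinberg"
  shows "(\<lambda>\<gamma>. f \<gamma> + g \<gamma>) \<in> steinberg"
proof -
  obtain F c d where F: "finite F" "\<forall>U\<in>F. cob U"
    "f = (\<lambda>\<gamma>. \<Sum>U\<in>F. c U * indicator U \<gamma>)" "g = (\<lambda>\<gamma>. \<Sum>U\<in>F. d U * indicator U \<gamma>)"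
    using assms by (rule steinberg_common)
  show ?thesis
    by (rule steinbergI[OF F(1,2), of _ "\<lambda>U. c U + d U"])
      (simp_all add: F(3,4) sum.distrib distrib_right)
qed

lemma steinberg_sum:
  assumes "finite F" "\<And>U. U \<in> F \<Longrightarrow> h U \<in> steinberg"
  shows "(\<lambda>\<gamma>. \<Sum>U\<in>F. h U \<gamma>) \<in> steinberg"
  using assms by (induction F) (auto simp: steinberg_zero steinberg_add)

lemma steinberg_conv:
  assumes "f \<in> steinberg" "g \<in> steinberg"
  shows "conv f g \<in> steinberg"
proof -
  obtain F c d where F: "finite F" "\<forall>U\<in>F. cob U"
    "f = (\<lambda>\<gamma>. \<Sum>U\<in>F. c U * indicator U \<gamma>)" "g = (\<lambda>\<gamma>. \<Sum>U\<in>F. d U * indicator U \<gamma>)"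
    using assms by (rule steinberg_common)
  have "conv (indicator U) g \<in> steinberg" if "U \<in> F" for U
    unfolding F(4) conv_sum_right[OF F(1,2)]
    using F that
    by (intro steinberg_sum steinberg_scale) (auto simp: conv_indicator_indicator cob_set_mult steinberg_indicator1)
  then show ?thesis
    unfolding F(3) conv_sum_left[OF F(1,2)] using F(1)
    by (intro steinberg_sum steinberg_scale) auto
qed

text \<open>Since convolution is linear in each argument and the indicators of compact open bisections
  span the algebra, compatibility with multiplication needs to be tested on these only.\<close>

lemma hemiring_congruenceI:
  fixes Q :: "('g \<Rightarrow> 'a::comm_semiring_1) \<Rightarrow> ('g \<Rightarrow> 'a) \<Rightarrow> bool"
  assumes refl: "\<And>f. f \<in> steinberg \<Longrightarrow> Q f f"
    and sym: "\<And>f g. Q f g \<Longrightarrow> Q g f"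
    and trans: "\<And>f g h. \<lbrakk>Q f g; Q g h\<rbrakk> \<Longrightarrow> Q f h"
    and add: "\<And>f g f' g'. \<lbrakk>f \<in> steinberg; g \<in> steinberg; f' \<in> steinberg; g' \<in> steinberg;
        Q f g; Q f' g'\<rbrakk> \<Longrightarrow> Q (\<lambda>\<gamma>. f \<gamma> + f' \<gamma>) (\<lambda>\<gamma>. g \<gamma> + g' \<gamma>)"
    and scale: "\<And>c f g. \<lbrakk>f \<in> steinberg; g \<in> steinberg; Q f g\<rbrakk> \<Longrightarrow> Q (\<lambda>\<gamma>. c * f \<gamma>) (\<lambda>\<gamma>. c * g \<gamma>)"
    and left: "\<And>B f g. \<lbrakk>cob B; f \<in> steinberg; g \<in> steinberg; Q f g\<rbrakk>
        \<Longrightarrow> Q (conv (indicator B) f) (conv (indicator B) g)"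
    and right: "\<And>B f g. \<lbrakk>cob B; f \<in> steinberg; g \<in> steinberg; Q f g\<rbrakk>
        \<Longrightarrow> Q (conv f (indicator B)) (conv g (indicator B))"
  shows "hemiring_congruence steinberg (\<lambda>f g \<gamma>. f \<gamma> + g \<gamma>) conv
      {(f, g). f \<in> steinberg \<and> g \<in> steinberg \<and> Q f g}"
proof -
  have sum: "Q (\<lambda>\<gamma>. \<Sum>U\<in>F. c U * f U \<gamma>) (\<lambda>\<gamma>. \<Sum>U\<in>F. c U * g U \<gamma>)"
    if "finite F" "\<And>U. U \<in> F \<Longrightarrow> f U \<in> steinberg \<and> g U \<in> steinberg \<and> Q (f U) (g U)"
    for F and c :: "'g set \<Rightarrow> 'a" and f g
    using that
  proof (induction F)
    case empty
    then show ?case by (simp add: refl steinberg_zero)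
  next
    case (insert U F)
    then have "Q (\<lambda>\<gamma>. c U * f U \<gamma> + (\<Sum>U\<in>F. c U * f U \<gamma>)) (\<lambda>\<gamma>. c U * g U \<gamma> + (\<Sum>U\<in>F. c U * g U \<gamma>))"
      by (intro add scale steinberg_sum steinberg_scale) auto
    then show ?case
      using insert by simp
  qed
  show ?thesis
    unfolding hemiring_congruence_def
  proof (intro conjI allI impI)
    show "equiv steinberg {(f, g). f \<in> steinberg \<and> g \<in> steinberg \<and> Q f g}"
      by (rule equivI) (auto intro: refl sym trans simp: refl_on_def sym_def trans_def)
  next
    fix f g h :: "'g \<Rightarrow> 'a"
    assume fg: "(f, g) \<in> {(f, g). f \<in> steinberg \<and> g \<in> steinberg \<and> Q f g}" and h: "h \<in> steinberg"
    then show "(\<lambda>\<gamma>. f \<gamma> + h \<gamma>, \<lambda>\<gamma>. g \<gamma> + h \<gamma>) \<in> {(f, g). f \<in> steinberg \<and> g \<in> steinberg \<and> Q f g}"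
      by (auto intro: add refl steinberg_add)
    obtain F c where F: "finite F" "\<forall>U\<in>F. cob U" "h = (\<lambda>\<gamma>. \<Sum>U\<in>F. c U * indicator U \<gamma>)"
      using h by (rule steinbergE)
    have "Q (conv h f) (conv h g)"
      unfolding F(3) conv_sum_left[OF F(1,2)]
      by (rule sum[OF F(1)]) (use F fg in \<open>auto intro!: left steinberg_conv steinberg_indicator1\<close>)
    then show "(conv h f, conv h g) \<in> {(f, g). f \<in> steinberg \<and> g \<in> steinberg \<and> Q f g}"
      using fg h steinberg_conv by auto
    have "Q (conv f h) (conv g h)"
      unfolding F(3) conv_sum_right[OF F(1,2)]
      by (rule sum[OF F(1)]) (use F fg in \<open>auto intro!: right steinberg_conv steinberg_indicator1\<close>)
    then show "(conv f h, conv g h) \<in> {(f, g). f \<in> steinberg \<and> g \<in> steinberg \<and> Q f g}"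
      using fg h steinberg_conv by auto
  qed
qed

end

section \<open>Semifields: zero divisors and zero sums\<close>

lemma semifield_no_zero_divisors:
  assumes "semifield TYPE('a::comm_semiring_1)" "(a::'a) * b = 0"
  shows "a = 0 \<or> b = 0"
proof (rule ccontr)
  assume "\<not> (a = 0 \<or> b = 0)"
  then obtain x y where "a * x = 1" "b * y = 1"
    using assms(1) unfolding semifield_def by metis
  then have "(a * b) * (x * y) = 1"
    by (metis mult.assoc mult.commute mult_1)
  then show False
    using assms(2) by simp
qed

text \<open>One nontrivial zero sum makes every element negatable: dividing by \<open>a\<close>
  gives \<open>b * y\<close> as a negative of \<open>1\<close>, and its multiples are all the
  negatives.\<close>

lemma semifield_zerosumfree_or_field:
  assumes "semifield TYPE('a::comm_semiring_1)" "\<not> is_field TYPE('a)" "(a::'a) + b = 0"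
  shows "a = 0"
proof (rule ccontr)
  assume "a \<noteq> 0"
  then obtain y where "a * y = 1"
    using assms(1) by (auto simp: semifield_def)
  then have "x + x * (b * y) = 0" for x
    using assms(3) by (metis distrib_left distrib_right mult_1_right mult_zero_left mult_zero_right)
  then show False
    using assms(1,2) unfolding is_field_def by blast
qed

context ample
begin

lemma unit_cob_base:
  assumes "openin T V" "u \<in> V" "u \<in> G0"
  obtains K where "cob K" "u \<in> K" "K \<subseteq> V" "K \<subseteq> G0"
  using compact_open_base[OF assms] cob_unit by metis

lemma unit_cob_at:
  assumes "u \<in> G0"
  obtains K where "cob K" "u \<in> K" "K \<subseteq> G0"
  by (rule unit_cob_base[OF open_units assms assms]) (rule that)

lemma conv_zero_left: "conv (\<lambda>_. 0) g = (\<lambda>_. 0)"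
  using conv_sum_left[of "{}" _ g] by simp

lemma conv_zero_right: "conv f (\<lambda>_. 0) = (\<lambda>_. 0)"
  using conv_sum_right[of "{}" f] by simp

text \<open>The form in which simplicity is applied: the unrelated pair \<open>f0\<close>,
  \<open>g0\<close> excludes the full relation, so \<open>Q\<close> can only be equality on the
  algebra.\<close>

lemma congruence_simpleD:
  fixes Q :: "('g \<Rightarrow> 'a::comm_semiring_1) \<Rightarrow> ('g \<Rightarrow> 'a) \<Rightarrow> bool"
  assumes "steinberg_congruence_simple T s r m TYPE('a)"
    and "hemiring_congruence steinberg (\<lambda>f g \<gamma>. f \<gamma> + g \<gamma>) conv
      {(f, g). f \<in> steinberg \<and> g \<in> steinberg \<and> Q f g}"
    and "f0 \<in> steinberg" "g0 \<in> steinberg" "\<not> Q f0 g0"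
    and "f \<in> steinberg" "g \<in> steinberg" "Q f g"
  shows "f = g"
proof -
  have "{(f, g). f \<in> steinberg \<and> g \<in> steinberg \<and> Q f g} = steinberg \<times> steinberg \<or>
      {(f, g). f \<in> steinberg \<and> g \<in> steinberg \<and> Q f g} = Id_on steinberg"
    using assms(1,2) unfolding steinberg_congruence_simple_def congruence_simple_def by blast
  moreover have "(f0, g0) \<notin> {(f, g). f \<in> steinberg \<and> g \<in> steinberg \<and> Q f g}"
    "(f0, g0) \<in> steinberg \<times> steinberg"
    using assms by auto
  moreover have "(f, g) \<in> {(f, g). f \<in> steinberg \<and> g \<in> steinberg \<and> Q f g}"
    using assms by auto
  ultimately have "(f, g) \<in> Id_on steinberg"
    by blast
  then show ?thesis
    by (simp add: Id_on_iff)
qed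

subsection \<open>The coefficient semifield\<close>

lemma support_translation:
  fixes f g :: "'g \<Rightarrow> 'a::comm_semiring_1"
  assumes "cob B" "\<And>\<gamma>. f \<gamma> = 0 \<longleftrightarrow> g \<gamma> = 0"
  shows "conv (indicator B) f \<gamma> = 0 \<longleftrightarrow> conv (indicator B) g \<gamma> = 0"
  using assms(1) by (cases rule: conv_indicator_cases[where \<gamma>=\<gamma> and 'a='a]) (simp_all add: assms(2))

text \<open>Equality of supports respects addition because a sum vanishes only if both summands do,
  and scaling because there are no zero divisors.\<close>

lemma support_congruence:
  assumes S: "semifield TYPE('a::comm_semiring_1)" "\<not> is_field TYPE('a)"
  shows "hemiring_congruence steinberg (\<lambda>f g \<gamma>. f \<gamma> + g \<gamma>) conv
    {(f, g). f \<in> steinberg \<and> g \<in> steinberg \<and> (\<forall>\<gamma>. f \<gamma> = 0 \<longleftrightarrow> g \<gamma> = (0::'a))}"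
proof (rule hemiring_congruenceI)
  have sum_zero: "a + b = 0 \<longleftrightarrow> a = 0 \<and> b = 0" for a b :: 'a
    using semifield_zerosumfree_or_field[OF S, of a b] by auto
  have prod_zero: "a * b = 0 \<longleftrightarrow> a = 0 \<or> b = 0" for a b :: 'a
    using semifield_no_zero_divisors[OF S(1), of a b] by auto
  show "\<forall>\<gamma>. f \<gamma> + f' \<gamma> = 0 \<longleftrightarrow> g \<gamma> + g' \<gamma> = 0"
    if "\<forall>\<gamma>. f \<gamma> = 0 \<longleftrightarrow> g \<gamma> = 0" "\<forall>\<gamma>. f' \<gamma> = 0 \<longleftrightarrow> g' \<gamma> = 0" for f g f' g' :: "'g \<Rightarrow> 'a"
    using that by (simp add: sum_zero)
  show "\<forall>\<gamma>. c * f \<gamma> = 0 \<longleftrightarrow> c * g \<gamma> = 0"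
    if "\<forall>\<gamma>. f \<gamma> = 0 \<longleftrightarrow> g \<gamma> = 0" for c and f g :: "'g \<Rightarrow> 'a"
    using that by (simp add: prod_zero)
  show "\<forall>\<gamma>. conv (indicator B) f \<gamma> = 0 \<longleftrightarrow> conv (indicator B) g \<gamma> = 0"
    if "cob B" "\<forall>\<gamma>. f \<gamma> = 0 \<longleftrightarrow> g \<gamma> = 0" for B and f g :: "'g \<Rightarrow> 'a"
    using that support_translation by blast
  show "\<forall>\<gamma>. conv f (indicator B) \<gamma> = 0 \<longleftrightarrow> conv g (indicator B) \<gamma> = 0"
    if "cob B" "\<forall>\<gamma>. f \<gamma> = 0 \<longleftrightarrow> g \<gamma> = 0" for B and f g :: "'g \<Rightarrow> 'a"
    using that ample.support_translation[OF opposite, of B f g]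
    by (simp add: cob_opposite conv_opposite)
qed auto

lemma simple_imp_field_or_boolean:
  assumes S: "semifield TYPE('a::comm_semiring_1)" and ne: "G0 \<noteq> {}"
    and simple: "steinberg_congruence_simple T s r m TYPE('a)"
  shows "is_field TYPE('a) \<or> is_boolean_semifield TYPE('a)"
proof (cases "is_field TYPE('a)")
  case nf: False
  obtain u where "u \<in> G0"
    using ne by blast
  then obtain K where K: "cob K" "u \<in> K" "K \<subseteq> G0"
    by (rule unit_cob_at)
  have one: "x = 1" if "x \<noteq> 0" for x :: 'a
  proof -
    have "(\<lambda>\<gamma>. x * indicator K \<gamma>) = (\<lambda>\<gamma>. 1 * indicator K \<gamma>)"
    proof (rule congruence_simpleD[OF simple support_congruence[OF S nf]])
      show "\<not> (\<forall>\<gamma>. 1 * indicator K \<gamma> = (0::'a) \<longleftrightarrow> (0::'a) = 0)"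
        using K(2) by (auto intro!: exI[of _ u])
      show "\<forall>\<gamma>. x * indicator K \<gamma> = 0 \<longleftrightarrow> 1 * indicator K \<gamma> = (0::'a)"
        using that by (simp add: indicator_def)
    qed (intro steinberg_indicator steinberg_zero K(1))+
    from fun_cong[OF this, of u] show ?thesis
      using K(2) by simp
  qed
  \<comment> \<open>Every nonzero element is \<open>1\<close>, so it remains to see that
    \<open>1 + 1\<close> is nonzero; this excludes the field with two elements.\<close>
  moreover have "(1::'a) + 1 \<noteq> 0"
    using semifield_zerosumfree_or_field[OF S nf, of 1 1] by auto
  ultimately show ?thesis
    unfolding is_boolean_semifield_def by blast
qed simp

subsection \<open>Minimality\<close>

text \<open>Left translation does not change sources, so agreement away from \<open>D\<close> is
  read off at an arrow with the same source as \<gamma>.\<close>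

lemma invariant_translation:
  fixes f g :: "'g \<Rightarrow> 'a::comm_semiring_1"
  assumes "cob B" "\<forall>\<gamma>\<in>G. s \<gamma> \<notin> D \<longrightarrow> f \<gamma> = g \<gamma>"
  shows "\<forall>\<gamma>\<in>G. s \<gamma> \<notin> D \<longrightarrow> conv (indicator B) f \<gamma> = conv (indicator B) g \<gamma>"
proof (intro ballI impI)
  fix \<gamma> assume "\<gamma> \<in> G" "s \<gamma> \<notin> D"
  with assms(1) show "conv (indicator B) f \<gamma> = conv (indicator B) g \<gamma>"
    by (cases rule: conv_indicator_cases[where \<gamma>=\<gamma> and 'a='a]) (simp_all add: assms(2))
qed

lemma invariant_set_iff:
  assumes "invariant_set T G0 s r D" "\<gamma> \<in> G"
  shows "r \<gamma> \<in> D \<longleftrightarrow> s \<gamma> \<in> D"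
  using assms i_in[OF assms(2)] s_i[OF assms(2)] r_i[OF assms(2)]
  unfolding invariant_set_def by metis

text \<open>Right translation preserves ranges instead of sources; invariance, which makes
  \<open>r \<gamma> \<in> D\<close> and \<open>s \<gamma> \<in> D\<close> equivalent, transfers the
  argument to that side.\<close>

lemma invariant_congruence:
  assumes D: "invariant_set T G0 s r D"
  shows "hemiring_congruence steinberg (\<lambda>f g \<gamma>. f \<gamma> + g \<gamma>) conv
    {(f, g). f \<in> steinberg \<and> g \<in> steinberg \<and> (\<forall>\<gamma>\<in>G. s \<gamma> \<notin> D \<longrightarrow> f \<gamma> = (g \<gamma> :: 'a::comm_semiring_1))}"
proof (rule hemiring_congruenceI)
  show "\<forall>\<gamma>\<in>G. s \<gamma> \<notin> D \<longrightarrow> conv f (indicator B) \<gamma> = conv g (indicator B) \<gamma>"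
    if "cob B" "\<forall>\<gamma>\<in>G. s \<gamma> \<notin> D \<longrightarrow> f \<gamma> = g \<gamma>" for B and f g :: "'g \<Rightarrow> 'a"
    using that ample.invariant_translation[OF opposite, of B D f g] invariant_set_iff[OF D]
    by (simp add: cob_opposite conv_opposite)
  show "\<forall>\<gamma>\<in>G. s \<gamma> \<notin> D \<longrightarrow> conv (indicator B) f \<gamma> = conv (indicator B) g \<gamma>"
    if "cob B" "\<forall>\<gamma>\<in>G. s \<gamma> \<notin> D \<longrightarrow> f \<gamma> = g \<gamma>" for B and f g :: "'g \<Rightarrow> 'a"
    using invariant_translation[OF that] .
qed auto

lemma simple_imp_minimal:
  assumes simple: "steinberg_congruence_simple T s r m TYPE('a::comm_semiring_1)"
  shows "minimal_groupoid T G0 s r"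
  unfolding minimal_groupoid_def
proof (intro allI impI, elim conjE)
  fix D assume D: "openin X D" "invariant_set T G0 s r D"
  show "D = {} \<or> D = G0"
  proof (rule ccontr)
    assume "\<not> (D = {} \<or> D = G0)"
    then obtain u v where uv: "u \<in> D" "u \<in> G0" "v \<in> G0" "v \<notin> D"
      using D(1) openin_X_iff by blast
    obtain K where K: "cob K" "u \<in> K" "K \<subseteq> D" "K \<subseteq> G0"
      using unit_cob_base[of D u] D(1) uv openin_X_iff by blast
    obtain L where L: "cob L" "v \<in> L" "L \<subseteq> G0"
      using uv(3) by (rule unit_cob_at)
    \<comment> \<open>The indicator of \<open>K\<close>, supported over \<open>D\<close>, is related
      to zero; the indicator of \<open>L\<close>, which is \<open>1\<close> at the unit
      \<open>v\<close> outside \<open>D\<close>, is not.\<close>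
    have "(indicator K :: 'g \<Rightarrow> 'a) = (\<lambda>_. 0)"
    proof (rule congruence_simpleD[OF simple invariant_congruence[OF D(2)]])
      show "\<not> (\<forall>\<gamma>\<in>G. s \<gamma> \<notin> D \<longrightarrow> indicator L \<gamma> = (0::'a))"
        using L(2) uv unit_in s_unit by (auto intro!: bexI[of _ v])
      have "s \<gamma> \<in> D" if "\<gamma> \<in> K" for \<gamma>
        using that K(3,4) s_unit by (metis subsetD)
      then show "\<forall>\<gamma>\<in>G. s \<gamma> \<notin> D \<longrightarrow> indicator K \<gamma> = (0::'a)"
        by (auto simp: indicator_def)
    qed (intro steinberg_indicator1 steinberg_zero K(1) L(1))+
    from fun_cong[OF this, of u] show False
      using K(2) by simp
  qed
qed

subsection \<open>Dense equalizers\<close>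

text \<open>Translate \<open>V\<close> back by the inverse bisection, find an open \<open>W\<close>
  of agreement inside, and translate it forward: the product of \<open>B\<close> and
  \<open>W\<close> is open and lies in \<open>V\<close>. If no arrow of \<open>V\<close> has its
  range in \<open>r(B)\<close>, both convolutions vanish on \<open>V\<close>.\<close>

lemma generic_translation:
  fixes f g :: "'g \<Rightarrow> 'a::comm_semiring_1"
  assumes B: "cob B"
    and fg: "\<And>V. \<lbrakk>openin T V; V \<noteq> {}\<rbrakk> \<Longrightarrow> \<exists>W. openin T W \<and> W \<noteq> {} \<and> W \<subseteq> V \<and> (\<forall>\<gamma>\<in>W. f \<gamma> = g \<gamma>)"
    and V: "openin T V" "V \<noteq> {}"
  shows "\<exists>W. openin T W \<and> W \<noteq> {} \<and> W \<subseteq> V \<and>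
    (\<forall>\<gamma>\<in>W. conv (indicator B) f \<gamma> = conv (indicator B) g \<gamma>)"
proof (cases "\<exists>\<gamma>\<in>V. r \<gamma> \<in> r ` B")
  case False
  then have "\<forall>\<gamma>\<in>V. conv (indicator B) f \<gamma> = conv (indicator B) g \<gamma>"
    by (auto simp: conv_indicator_left_zero)
  then show ?thesis
    using V by blast
next
  case True
  then obtain v b where vb: "v \<in> V" "b \<in> B" "r v = r b"
    by auto
  have BG: "B \<subseteq> G" "inj_on s B"
    using B cob_subset cob_iff by auto
  have VG: "V \<subseteq> G"
    using V openin_subset by blast
  have "i b \<in> i ` B" "s (i b) = r v"
    using vb BG s_i by auto
  then have "m (i b) v \<in> set_mult (i ` B) V"
    unfolding set_mult_def using vb(1) by blast
  then obtain W where W: "openin T W" "W \<noteq> {}" "W \<subseteq> set_mult (i ` B) V" "\<forall>\<gamma>\<in>W. f \<gamma> = g \<gamma>"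
    using fg[OF open_set_mult[OF cob_inverse[OF B] V(1)]] by blast
  have W_cases: "\<exists>b v. b \<in> B \<and> v \<in> V \<and> r b = r v \<and> w = m (i b) v" if "w \<in> W" for w
  proof -
    obtain b v where "b \<in> B" "v \<in> V" "s (i b) = r v" "w = m (i b) v"
      using subsetD[OF W(3) \<open>w \<in> W\<close>] unfolding set_mult_def by auto
    then show ?thesis
      using BG(1) s_i by (metis subsetD)
  qed
  \<comment> \<open>Injectivity of \<open>s\<close> on \<open>B\<close> forces the arrow that brings
    \<open>w\<close> forward to be the one that brought it back, so the two translations
    cancel.\<close>
  have in_V: "m b w \<in> V" if bw: "b \<in> B" "w \<in> W" "s b = r w" for b w
  proof -
    obtain b' v' where *: "b' \<in> B" "v' \<in> V" "r b' = r v'" "w = m (i b') v'"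
      using W_cases[OF bw(2)] by blast
    then have G: "b' \<in> G" "v' \<in> G" "b \<in> G"
      using bw(1) BG VG by auto
    have "s b' = s b"
      using bw(3) * G by (simp add: r_m i_in s_i r_i)
    then have "b' = b"
      using BG(2) * bw inj_onD by metis
    then show ?thesis
      using * G m_i_cancel by simp
  qed
  have "set_mult B W \<noteq> {}"
  proof -
    obtain w where "w \<in> W"
      using W(2) by blast
    then obtain b' v' where *: "b' \<in> B" "v' \<in> V" "r b' = r v'" "w = m (i b') v'"
      using W_cases by blast
    then have "s b' = r w"
      using BG VG by (auto simp: r_m i_in s_i r_i subset_iff)
    then show ?thesis
      using * \<open>w \<in> W\<close> by (auto simp: set_mult_def)
  qed
  moreover have "conv (indicator B) f \<gamma> = conv (indicator B) g \<gamma>" if "\<gamma> \<in> set_mult B W" for \<gamma>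
  proof -
    obtain b w where bw: "\<gamma> = m b w" "b \<in> B" "w \<in> W" "s b = r w"
      using \<open>\<gamma> \<in> set_mult B W\<close> by (auto simp: set_mult_def)
    moreover have "w \<in> G"
      using bw W(1) openin_subset by blast
    ultimately show ?thesis
      using conv_indicator_left[OF B] W(4) by metis
  qed
  moreover have "set_mult B W \<subseteq> V"
    using in_V by (auto simp: set_mult_def)
  ultimately show ?thesis
    using open_set_mult[OF B W(1)] by blast
qed

text \<open>The relation says that the union of all open sets of agreement is dense. In this local
  form no dense set has to be carried along, and transitivity and addition follow by shrinking
  twice.\<close>

lemma generic_congruence:
  "hemiring_congruence steinberg (\<lambda>f g \<gamma>. f \<gamma> + g \<gamma>) conv
    {(f, g). f \<in> steinberg \<and> g \<in> steinberg \<and>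
      (\<forall>V. openin T V \<longrightarrow> V \<noteq> {} \<longrightarrow>
        (\<exists>W. openin T W \<and> W \<noteq> {} \<and> W \<subseteq> V \<and> (\<forall>\<gamma>\<in>W. f \<gamma> = (g \<gamma> :: 'a::comm_semiring_1))))}"
  (is "hemiring_congruence _ _ _ {(f, g). _ f \<and> _ g \<and> ?Q f g}")
proof (rule hemiring_congruenceI)
  fix f g h :: "'g \<Rightarrow> 'a"
  assume fg: "?Q f g" and gh: "?Q g h"
  show "?Q f h"
  proof (intro allI impI)
    fix V assume V: "openin T V" "V \<noteq> {}"
    obtain W where W: "openin T W" "W \<noteq> {}" "W \<subseteq> V" "\<forall>\<gamma>\<in>W. f \<gamma> = g \<gamma>"
      using fg[rule_format, OF V] by blast
    obtain W' where "openin T W'" "W' \<noteq> {}" "W' \<subseteq> W" "\<forall>\<gamma>\<in>W'. g \<gamma> = h \<gamma>"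
      using gh[rule_format, OF W(1,2)] by blast
    then show "\<exists>W. openin T W \<and> W \<noteq> {} \<and> W \<subseteq> V \<and> (\<forall>\<gamma>\<in>W. f \<gamma> = h \<gamma>)"
      using W by (intro exI[of _ W']) auto
  qed
next
  fix f g f' g' :: "'g \<Rightarrow> 'a"
  assume fg: "?Q f g" and fg': "?Q f' g'"
  show "?Q (\<lambda>\<gamma>. f \<gamma> + f' \<gamma>) (\<lambda>\<gamma>. g \<gamma> + g' \<gamma>)"
  proof (intro allI impI)
    fix V assume V: "openin T V" "V \<noteq> {}"
    obtain W where W: "openin T W" "W \<noteq> {}" "W \<subseteq> V" "\<forall>\<gamma>\<in>W. f \<gamma> = g \<gamma>"
      using fg[rule_format, OF V] by blast
    obtain W' where "openin T W'" "W' \<noteq> {}" "W' \<subseteq> W" "\<forall>\<gamma>\<in>W'. f' \<gamma> = g' \<gamma>"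
      using fg'[rule_format, OF W(1,2)] by blast
    then show "\<exists>W. openin T W \<and> W \<noteq> {} \<and> W \<subseteq> V \<and> (\<forall>\<gamma>\<in>W. f \<gamma> + f' \<gamma> = g \<gamma> + g' \<gamma>)"
      using W by (intro exI[of _ W']) auto
  qed
next
  fix c and f g :: "'g \<Rightarrow> 'a" assume "?Q f g"
  then show "?Q (\<lambda>\<gamma>. c * f \<gamma>) (\<lambda>\<gamma>. c * g \<gamma>)"
    by metis
next
  fix B and f g :: "'g \<Rightarrow> 'a" assume B: "cob B" and fg: "?Q f g"
  show "?Q (conv (indicator B) f) (conv (indicator B) g)"
    using generic_translation[OF B, of f g] fg by simp
  show "?Q (conv f (indicator B)) (conv g (indicator B))"
    using ample.generic_translation[OF opposite, of B f g] B fg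
    by (simp add: conv_opposite cob_opposite)
next
  show "?Q f g \<Longrightarrow> ?Q g f" for f g :: "'g \<Rightarrow> 'a"
    by metis
qed auto

text \<open>On the resulting \<open>W\<close> the indicator of each member of \<open>F\<close> is
  constant, and hence so is every combination of these indicators.\<close>

lemma generic_refinement:
  assumes "finite F" "\<forall>U\<in>F. openin T U" "openin T V" "V \<noteq> {}"
  shows "\<exists>W. openin T W \<and> W \<noteq> {} \<and> W \<subseteq> V \<and> (\<forall>U\<in>F. W \<subseteq> U \<or> W \<inter> U = {})"
  using assms
proof (induction F)
  case (insert U F)
  then obtain W where W: "openin T W" "W \<noteq> {}" "W \<subseteq> V" "\<forall>U\<in>F. W \<subseteq> U \<or> W \<inter> U = {}"
    by auto
  show ?case
  proof (cases "W \<inter> U = {}")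
    case True
    then show ?thesis using W by (intro exI[of _ W]) auto
  next
    case False
    then show ?thesis
      using W insert.prems by (intro exI[of _ "W \<inter> U"]) (simp, blast)
  qed
qed auto

lemma simple_imp_not_dense:
  fixes f g :: "'g \<Rightarrow> 'a::comm_semiring_1"
  assumes simple: "steinberg_congruence_simple T s r m TYPE('a)" and ne: "G0 \<noteq> {}"
    and fg: "f \<in> steinberg" "g \<in> steinberg" and dense: "T closure_of {\<alpha> \<in> G. f \<alpha> = g \<alpha>} = G"
  shows "f = g"
proof -
  obtain u where "u \<in> G0"
    using ne by blast
  then obtain K where K: "cob K" "u \<in> K" "K \<subseteq> G0"
    by (rule unit_cob_at)
  show ?thesis
  proof (rule congruence_simpleD[OF simple generic_congruence])
    show "\<not> (\<forall>V. openin T V \<longrightarrow> V \<noteq> {} \<longrightarrow>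
        (\<exists>W. openin T W \<and> W \<noteq> {} \<and> W \<subseteq> V \<and> (\<forall>\<gamma>\<in>W. indicator K \<gamma> = (0::'a))))"
      using K cob_iff[of K] by (auto intro!: exI[of _ K]) (metis indicator_simps(1) subset_empty subset_iff zero_neq_one)
    show "\<forall>V. openin T V \<longrightarrow> V \<noteq> {} \<longrightarrow>
        (\<exists>W. openin T W \<and> W \<noteq> {} \<and> W \<subseteq> V \<and> (\<forall>\<gamma>\<in>W. f \<gamma> = g \<gamma>))"
    proof (intro allI impI)
      fix V assume V: "openin T V" "V \<noteq> {}"
      obtain F c d where F: "finite F" "\<forall>U\<in>F. cob U"
        "f = (\<lambda>\<gamma>. \<Sum>U\<in>F. c U * indicator U \<gamma>)" "g = (\<lambda>\<gamma>. \<Sum>U\<in>F. d U * indicator U \<gamma>)"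
        using fg by (rule steinberg_common)
      obtain W where W: "openin T W" "W \<noteq> {}" "W \<subseteq> V" "\<forall>U\<in>F. W \<subseteq> U \<or> W \<inter> U = {}"
        using generic_refinement[OF F(1) _ V] F(2) cob_iff by blast
      \<comment> \<open>Both functions are constant on \<open>W\<close>, so the single point of
        agreement provided by density gives agreement on all of \<open>W\<close>.\<close>
      obtain \<alpha> where \<alpha>: "\<alpha> \<in> W" "f \<alpha> = g \<alpha>"
        using dense W(1,2) unfolding dense_intersects_open by blast
      have "indicator U \<gamma> = (indicator U \<alpha> :: 'a)" if "\<gamma> \<in> W" "U \<in> F" for \<gamma> U
        using that W(4) \<alpha>(1) by (auto simp: indicator_def)
      then have "f \<gamma> = f \<alpha>" "g \<gamma> = g \<alpha>" if "\<gamma> \<in> W" for \<gamma>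
        using that unfolding F(3,4) by (auto intro!: sum.cong)
      then have "\<forall>\<gamma>\<in>W. f \<gamma> = g \<gamma>"
        using \<alpha>(2) by metis
      then show "\<exists>W. openin T W \<and> W \<noteq> {} \<and> W \<subseteq> V \<and> (\<forall>\<gamma>\<in>W. f \<gamma> = g \<gamma>)"
        using W(1-3) by blast
    qed
  qed (intro steinberg_indicator1 steinberg_zero K(1) fg)+
qed

end

subsection \<open>Effectiveness\<close>

text \<open>The entry at \<open>(v, u)\<close> of the matrix by which \<open>f\<close> acts on
  functions on the units: an arrow sends its source to its range, and arrows with the same end
  points are not distinguished. Restricting to nonzero terms keeps the index set finite for elements
  of the algebra; a sum over an infinite set would be \<open>0\<close>.\<close>

definition isotropy_sum ::
  "'g topology \<Rightarrow> ('g \<Rightarrow> 'g) \<Rightarrow> ('g \<Rightarrow> 'g) \<Rightarrow> ('g \<Rightarrow> 'a::comm_semiring_1) \<Rightarrow> 'g \<Rightarrow> 'g \<Rightarrow> 'a" where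
  "isotropy_sum T s r f u v = (\<Sum>\<gamma> | \<gamma> \<in> topspace T \<and> s \<gamma> = u \<and> r \<gamma> = v \<and> f \<gamma> \<noteq> 0. f \<gamma>)"

lemma isotropy_sum_opposite: "isotropy_sum T r s f v u = isotropy_sum T s r f u v"
  by (simp add: isotropy_sum_def conj_left_commute conj_commute)

lemma isotropy_sum_eq:
  assumes "finite P" "P \<subseteq> {\<gamma> \<in> topspace T. s \<gamma> = u \<and> r \<gamma> = v}"
    and "\<And>\<gamma>. \<lbrakk>\<gamma> \<in> topspace T; s \<gamma> = u; r \<gamma> = v; f \<gamma> \<noteq> 0\<rbrakk> \<Longrightarrow> \<gamma> \<in> P"
  shows "isotropy_sum T s r f u v = sum f P"
  unfolding isotropy_sum_def by (rule sum.mono_neutral_left) (use assms in auto)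

context ample
begin

abbreviation isosum :: "('g \<Rightarrow> 'a::comm_semiring_1) \<Rightarrow> 'g \<Rightarrow> 'g \<Rightarrow> 'a" where
  "isosum \<equiv> isotropy_sum T s r"

lemma isotropy_fiber:
  assumes "finite F" "\<forall>U\<in>F. cob U"
  shows "finite {\<gamma> \<in> \<Union>F. s \<gamma> = u \<and> r \<gamma> = v}"
    and "{\<gamma> \<in> \<Union>F. s \<gamma> = u \<and> r \<gamma> = v} \<subseteq> {\<gamma> \<in> G. s \<gamma> = u \<and> r \<gamma> = v}"
proof -
  show "finite {\<gamma> \<in> \<Union>F. s \<gamma> = u \<and> r \<gamma> = v}"
    by (rule finite_subset[OF _ fiber_finite[OF assms, of v]]) auto
  show "{\<gamma> \<in> \<Union>F. s \<gamma> = u \<and> r \<gamma> = v} \<subseteq> {\<gamma> \<in> G. s \<gamma> = u \<and> r \<gamma> = v}"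
    using assms(2) cob_subset by blast
qed

lemma isosum_add:
  fixes f g :: "'g \<Rightarrow> 'a::comm_semiring_1"
  assumes "f \<in> steinberg" "g \<in> steinberg"
  shows "isosum (\<lambda>\<gamma>. f \<gamma> + g \<gamma>) u v = isosum f u v + isosum g u v"
proof -
  obtain F c d where F: "finite F" "\<forall>U\<in>F. cob U"
    "f = (\<lambda>\<gamma>. \<Sum>U\<in>F. c U * indicator U \<gamma>)" "g = (\<lambda>\<gamma>. \<Sum>U\<in>F. d U * indicator U \<gamma>)"
    using assms by (rule steinberg_common)
  \<comment> \<open>The nonzero terms of \<open>f\<close>, of \<open>g\<close> and of their sum may
    form three different sets; the finite set \<open>P\<close> contains them all.\<close>
  define P where "P = {\<gamma> \<in> \<Union>F. s \<gamma> = u \<and> r \<gamma> = v}"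
  have P: "finite P" "P \<subseteq> {\<gamma> \<in> G. s \<gamma> = u \<and> r \<gamma> = v}"
    unfolding P_def using isotropy_fiber[OF F(1,2)] by auto
  have f: "\<gamma> \<in> P" if "s \<gamma> = u" "r \<gamma> = v" "f \<gamma> \<noteq> 0" for \<gamma>
    using combination_support[of c \<gamma> F] that unfolding P_def F(3) by blast
  have g: "\<gamma> \<in> P" if "s \<gamma> = u" "r \<gamma> = v" "g \<gamma> \<noteq> 0" for \<gamma>
    using combination_support[of d \<gamma> F] that unfolding P_def F(4) by blast
  have "\<gamma> \<in> P" if "s \<gamma> = u" "r \<gamma> = v" "f \<gamma> + g \<gamma> \<noteq> 0" for \<gamma>
    using f g that by (metis add_0_right)
  then have "isosum (\<lambda>\<gamma>. f \<gamma> + g \<gamma>) u v = (\<Sum>\<gamma>\<in>P. f \<gamma> + g \<gamma>)"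
    by (rule isotropy_sum_eq[OF P(1,2)])
  moreover have "isosum f u v = sum f P" "isosum g u v = sum g P"
    by (rule isotropy_sum_eq[OF P(1,2)]; use f g in blast)+
  ultimately show ?thesis
    by (simp add: sum.distrib)
qed

lemma isosum_scale:
  fixes f :: "'g \<Rightarrow> 'a::comm_semiring_1"
  assumes "f \<in> steinberg"
  shows "isosum (\<lambda>\<gamma>. c * f \<gamma>) u v = c * isosum f u v"
proof -
  obtain F d where F: "finite F" "\<forall>U\<in>F. cob U" "f = (\<lambda>\<gamma>. \<Sum>U\<in>F. d U * indicator U \<gamma>)"
    using assms by (rule steinbergE)
  define P where "P = {\<gamma> \<in> \<Union>F. s \<gamma> = u \<and> r \<gamma> = v}"
  have P: "finite P" "P \<subseteq> {\<gamma> \<in> G. s \<gamma> = u \<and> r \<gamma> = v}"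
    unfolding P_def using isotropy_fiber[OF F(1,2)] by auto
  have f: "\<gamma> \<in> P" if "s \<gamma> = u" "r \<gamma> = v" "f \<gamma> \<noteq> 0" for \<gamma>
    using combination_support[of d \<gamma> F] that unfolding P_def F(3) by blast
  have "\<gamma> \<in> P" if "s \<gamma> = u" "r \<gamma> = v" "c * f \<gamma> \<noteq> 0" for \<gamma>
    using f that by (metis mult_zero_right)
  then have "isosum (\<lambda>\<gamma>. c * f \<gamma>) u v = (\<Sum>\<gamma>\<in>P. c * f \<gamma>)"
    by (rule isotropy_sum_eq[OF P(1,2)])
  moreover have "isosum f u v = sum f P"
    by (rule isotropy_sum_eq[OF P(1,2)]; use f in blast)
  ultimately show ?thesis
    by (simp add: sum_distrib_left)
qed

text \<open>Left multiplication by \<open>b\<close> maps the arrows from \<open>u\<close> to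
  \<open>s b\<close> bijectively onto those from \<open>u\<close> to \<open>r b\<close>, with
  inverse the multiplication by \<open>i b\<close>, and it carries \<open>f\<close> to the
  convolution.\<close>

lemma isosum_translation:
  fixes f :: "'g \<Rightarrow> 'a::comm_semiring_1"
  assumes B: "cob B" and b: "b \<in> B"
  shows "isosum (conv (indicator B) f) u (r b) = isosum f u (s b)"
proof -
  have bG: "b \<in> G"
    using B b cob_subset by blast
  have shift: "conv (indicator B) f (m b \<delta>) = f \<delta>" if "\<delta> \<in> G" "s b = r \<delta>" for \<delta>
    using conv_indicator_left[OF B b that] .
  have inv: "m (i b) \<gamma> \<in> G" "s b = r (m (i b) \<gamma>)" "m b (m (i b) \<gamma>) = \<gamma>" "s (m (i b) \<gamma>) = s \<gamma>"
    if "\<gamma> \<in> G" "r \<gamma> = r b" for \<gamma>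
    using that bG by (simp_all add: m_in i_in s_i r_i r_m s_m m_i_cancel)
  have shift': "f (m (i b) \<gamma>) = conv (indicator B) f \<gamma>" if "\<gamma> \<in> G" "r \<gamma> = r b" for \<gamma>
    using shift[OF inv(1,2)[OF that]] inv(3)[OF that] by simp
  show ?thesis
    unfolding isotropy_sum_def
  proof (rule sum.reindex_bij_witness[of _ "m b" "m (i b)"], goal_cases)
    case (1 \<gamma>) then show ?case using inv(3) by simp
  next
    case (2 \<gamma>) then show ?case using inv[of \<gamma>] shift'[of \<gamma>] by simp
  next
    case (3 \<delta>) then show ?case using i_m_cancel bG by simp
  next
    case (4 \<delta>) then show ?case using shift[of \<delta>] bG by (simp add: m_in r_m s_m)
  next
    case (5 \<gamma>) then show ?case using shift'[of \<gamma>] by simp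
  qed
qed

lemma isosum_translation_eq:
  fixes f g :: "'g \<Rightarrow> 'a::comm_semiring_1"
  assumes "cob B" "\<forall>u v. isosum f u v = isosum g u v"
  shows "isosum (conv (indicator B) f) u v = isosum (conv (indicator B) g) u v"
proof (cases "v \<in> r ` B")
  case True
  then obtain b where "b \<in> B" "v = r b"
    by auto
  then show ?thesis
    using isosum_translation[OF assms(1)] assms(2) by metis
next
  case False
  then have "{\<gamma>. \<gamma> \<in> G \<and> s \<gamma> = u \<and> r \<gamma> = v \<and> conv (indicator B) h \<gamma> \<noteq> 0} = {}" for h :: "'g \<Rightarrow> 'a"
    using conv_indicator_left_zero by blast
  then show ?thesis
    unfolding isotropy_sum_def by (simp only: sum.empty)
qed

lemma isosum_congruence:
  "hemiring_congruence steinberg (\<lambda>f g \<gamma>. f \<gamma> + g \<gamma>) conv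
    {(f, g). f \<in> steinberg \<and> g \<in> steinberg \<and>
      (\<forall>u v. isosum f u v = (isosum g u v :: 'a::comm_semiring_1))}"
proof (rule hemiring_congruenceI)
  show "\<forall>u v. isosum (conv (indicator B) f) u v = isosum (conv (indicator B) g) u v"
    if "cob B" "\<forall>u v. isosum f u v = isosum g u v" for B and f g :: "'g \<Rightarrow> 'a"
    using isosum_translation_eq[OF that] by blast
  show "\<forall>u v. isosum (conv f (indicator B)) u v = isosum (conv g (indicator B)) u v"
    if "cob B" "\<forall>u v. isosum f u v = isosum g u v" for B and f g :: "'g \<Rightarrow> 'a"
    using that ample.isosum_translation_eq[OF opposite, of B f g]
    by (simp add: cob_opposite conv_opposite isotropy_sum_opposite)
qed (simp_all add: isosum_add isosum_scale)

text \<open>A compact open bisection \<open>B\<close> inside the isotropy cannot be told apart from its source by the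
  sums over the sets of arrows with given end points.\<close>

lemma simple_imp_effective:
  assumes simple: "steinberg_congruence_simple T s r m TYPE('a::comm_semiring_1)"
  shows "effective_groupoid T G0 s r"
proof (rule ccontr)
  let ?Iso = "{\<gamma> \<in> G. s \<gamma> = r \<gamma>}"
  assume "\<not> effective_groupoid T G0 s r"
  moreover have "G0 \<subseteq> T interior_of ?Iso"
    using open_units unit_in s_unit r_unit by (intro interior_of_maximal) auto
  ultimately obtain \<gamma> where \<gamma>: "\<gamma> \<in> T interior_of ?Iso" "\<gamma> \<notin> G0"
    unfolding effective_groupoid_def by blast
  obtain B where B: "cob B" "\<gamma> \<in> B" "B \<subseteq> T interior_of ?Iso"
    using cob_base[OF openin_interior_of \<gamma>(1)] .
  have BG: "B \<subseteq> G" "inj_on s B" "compactin T B" "openin T B"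
    using B(1) cob_subset cob_iff by auto
  have iso: "r \<beta> = s \<beta>" if "\<beta> \<in> B" for \<beta>
    using that B(3) interior_of_subset by fastforce
  have sB: "s ` B \<subseteq> G0"
    using BG(1) s_in by blast
  have cob_sB: "cob (s ` B)"
    using cob_unit[OF compact_image_s open_image_s] BG sB by blast
  have "s \<gamma> \<in> G0"
    using \<gamma>(1) B(2) sB by blast
  then obtain K where K: "cob K" "s \<gamma> \<in> K" "K \<subseteq> G0"
    by (rule unit_cob_at)
  have eq: "(indicator B :: 'g \<Rightarrow> 'a) = indicator (s ` B)"
  proof (rule congruence_simpleD[OF simple isosum_congruence])
    \<comment> \<open>The relation is not full: \<open>K\<close> consists of units, so its only
      arrow starting at \<open>s \<gamma>\<close> is that unit, and the indicator of
      \<open>K\<close> has sum \<open>1\<close> where zero has sum \<open>0\<close>.\<close>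
    have "isosum (indicator K) (s \<gamma>) (s \<gamma>) = (sum (indicator K) {s \<gamma>} :: 'a)"
    proof (rule isotropy_sum_eq)
      show "\<beta> \<in> {s \<gamma>}" if "s \<beta> = s \<gamma>" "indicator K \<beta> \<noteq> (0::'a)" for \<beta>
      proof -
        have "\<beta> \<in> K"
          using that(2) by (cases "\<beta> \<in> K") auto
        then show ?thesis
          using that(1) K(3) s_unit[of \<beta>] by auto
      qed
    qed (use \<open>s \<gamma> \<in> G0\<close> unit_in s_unit r_unit in auto)
    then have "isosum (indicator K) (s \<gamma>) (s \<gamma>) = (1::'a)"
      using K(2) by simp
    moreover have "isosum (\<lambda>_. 0) (s \<gamma>) (s \<gamma>) = (0::'a)"
      by (simp add: isotropy_sum_def)
    ultimately have "isosum (indicator K) (s \<gamma>) (s \<gamma>) \<noteq> isosum (\<lambda>_. 0::'a) (s \<gamma>) (s \<gamma>)"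
      by simp
    then show "\<not> (\<forall>u v. isosum (indicator K) u v = isosum (\<lambda>_. 0::'a) u v)"
      by blast
    show "\<forall>u v. isosum (indicator B) u v = (isosum (indicator (s ` B)) u v :: 'a)"
    proof (intro allI)
      fix u v
      \<comment> \<open>Arrows of \<open>B\<close> have equal end points, so both index sets are
        empty unless \<open>u = v\<close>, and \<open>s\<close> maps the first one bijectively onto
        the second.\<close>
      have l: "{\<beta>. \<beta> \<in> G \<and> s \<beta> = u \<and> r \<beta> = v \<and> indicator B \<beta> \<noteq> (0::'a)} = {\<beta> \<in> B. s \<beta> = u \<and> u = v}"
        using BG(1) iso by (auto simp: indicator_def)
      have r: "{\<beta>. \<beta> \<in> G \<and> s \<beta> = u \<and> r \<beta> = v \<and> indicator (s ` B) \<beta> \<noteq> (0::'a)}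
          = s ` {\<beta> \<in> B. s \<beta> = u \<and> u = v}"
      proof (intro equalityI subsetI)
        fix \<beta> assume "\<beta> \<in> {\<beta>. \<beta> \<in> G \<and> s \<beta> = u \<and> r \<beta> = v \<and> indicator (s ` B) \<beta> \<noteq> (0::'a)}"
        then have *: "\<beta> \<in> s ` B" "s \<beta> = u" "r \<beta> = v"
          by (cases "\<beta> \<in> s ` B"; simp)+
        then show "\<beta> \<in> s ` {\<beta> \<in> B. s \<beta> = u \<and> u = v}"
          using sB s_unit r_unit by fastforce
      next
        fix \<beta> assume "\<beta> \<in> s ` {\<beta> \<in> B. s \<beta> = u \<and> u = v}"
        then show "\<beta> \<in> {\<beta>. \<beta> \<in> G \<and> s \<beta> = u \<and> r \<beta> = v \<and> indicator (s ` B) \<beta> \<noteq> (0::'a)}"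
          using sB s_unit r_unit unit_in by auto
      qed
      have "inj_on s {\<beta> \<in> B. s \<beta> = u \<and> u = v}"
        using BG(2) by (auto simp: inj_on_def)
      then show "isosum (indicator B) u v = (isosum (indicator (s ` B)) u v :: 'a)"
        unfolding isotropy_sum_def l r by (subst sum.reindex, assumption, intro sum.cong) (auto simp: indicator_def)
    qed
  qed (intro steinberg_indicator1 steinberg_zero B(1) K(1) cob_sB)+
  have "\<gamma> \<notin> s ` B"
    using \<gamma>(2) sB by blast
  then show False
    using fun_cong[OF eq, of \<gamma>] B(2) by simp
qed

subsection \<open>Sufficiency\<close>

text \<open>If \<open>W\<close> meets \<open>U\<close>, intersect. Otherwise the arrows of
  \<open>U\<close> from \<open>W\<close> to \<open>W\<close> form an open set \<open>V\<close>
  without units. If it is nonempty, effectiveness provides an arrow in it with distinct end points,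
  and separating these in the Hausdorff unit space gives a set of sources that \<open>U\<close>
  moves off itself.\<close>

lemma effective_refinement_one:
  assumes eff: "effective_groupoid T G0 s r" and U: "cob U"
    and W: "openin T W" "W \<noteq> {}" "W \<subseteq> G0"
  shows "\<exists>W'. openin T W' \<and> W' \<noteq> {} \<and> W' \<subseteq> W \<and> (W' \<subseteq> U \<or> (\<forall>\<gamma>\<in>U. \<not> (s \<gamma> \<in> W' \<and> r \<gamma> \<in> W')))"
proof (cases "W \<inter> U = {}")
  case False
  then show ?thesis
    using W U cob_iff by (intro exI[of _ "W \<inter> U"]) auto
next
  case WU: True
  have UG: "U \<subseteq> G" "openin T U" "inj_on s U"
    using U cob_subset cob_iff by auto
  show ?thesis
  proof (cases "\<exists>\<gamma>\<in>U. s \<gamma> \<in> W \<and> r \<gamma> \<in> W")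
    case False
    then show ?thesis
      using W by blast
  next
    case True
    define V where "V = {\<gamma> \<in> {\<gamma> \<in> U. s \<gamma> \<in> W}. r \<gamma> \<in> W}"
    have V: "openin T V" "V \<noteq> {}"
      using open_preimage_r[OF open_preimage_s[OF UG(2) W(1)] W(1)] True by (auto simp: V_def)
    have "V \<inter> G0 = {}"
      using WU s_unit by (auto simp: V_def)
    then have "\<not> V \<subseteq> {\<gamma> \<in> G. s \<gamma> = r \<gamma>}"
      using eff V interior_of_maximal[of V] unfolding effective_groupoid_def by blast
    then obtain \<gamma> where \<gamma>: "\<gamma> \<in> V" "s \<gamma> \<noteq> r \<gamma>" "\<gamma> \<in> G"
      using V(1) openin_subset by blast
    then obtain A A' where A: "openin X A" "openin X A'" "s \<gamma> \<in> A" "r \<gamma> \<in> A'" "disjnt A A'"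
      using Hausdorff_X s_in[OF \<gamma>(3)] r_in[OF \<gamma>(3)] unfolding Hausdorff_space_def topspace_X by meson
    \<comment> \<open>These are the arrows of \<open>V\<close> from \<open>A\<close> to
      \<open>A'\<close>. An arrow of \<open>U\<close> starting in \<open>s(V')\<close> belongs to
      \<open>V'\<close> by injectivity of \<open>s\<close>, so it ends in \<open>A'\<close>, which
      is disjoint from \<open>A\<close> and hence from \<open>s(V')\<close>.\<close>
    define V' where "V' = {\<beta> \<in> {\<beta> \<in> V. s \<beta> \<in> A}. r \<beta> \<in> A'}"
    have V': "openin T V'" "\<gamma> \<in> V'"
      using open_preimage_r[OF open_preimage_s[OF V(1)]] A \<gamma>(1) openin_X_iff by (auto simp: V'_def)
    have "\<not> (s \<beta> \<in> s ` V' \<and> r \<beta> \<in> s ` V')" if "\<beta> \<in> U" for \<beta>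
    proof
      assume *: "s \<beta> \<in> s ` V' \<and> r \<beta> \<in> s ` V'"
      then obtain \<beta>' where "\<beta>' \<in> V'" "s \<beta> = s \<beta>'"
        by auto
      then have "\<beta> \<in> V'"
        using inj_onD[OF UG(3), of \<beta> \<beta>'] that by (auto simp: V'_def V_def)
      then have "r \<beta> \<in> A'" "r \<beta> \<in> A"
        using * by (auto simp: V'_def)
      then show False
        using A(5) by (auto simp: disjnt_iff)
    qed
    moreover have "s ` V' \<subseteq> W"
      by (auto simp: V'_def V_def)
    ultimately show ?thesis
      using open_image_s[OF V'(1)] V'(2) by (intro exI[of _ "s ` V'"]) blast
  qed
qed

text \<open>Both alternatives are inherited by smaller sets of units, so the members of
  \<open>F\<close> can be treated one after another.\<close>

lemma effective_refinement:
  assumes eff: "effective_groupoid T G0 s r" and "finite F" "\<forall>U\<in>F. cob U"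
    and W: "openin T W" "W \<noteq> {}" "W \<subseteq> G0"
  shows "\<exists>W'. openin T W' \<and> W' \<noteq> {} \<and> W' \<subseteq> W \<and>
    (\<forall>U\<in>F. W' \<subseteq> U \<or> (\<forall>\<gamma>\<in>U. \<not> (s \<gamma> \<in> W' \<and> r \<gamma> \<in> W')))"
  using assms(2,3)
proof (induction F)
  case empty
  then show ?case using W by blast
next
  case (insert U F)
  then obtain W' where W': "openin T W'" "W' \<noteq> {}" "W' \<subseteq> W"
    "\<forall>U\<in>F. W' \<subseteq> U \<or> (\<forall>\<gamma>\<in>U. \<not> (s \<gamma> \<in> W' \<and> r \<gamma> \<in> W'))"
    by auto
  have "cob U" "W' \<subseteq> G0"
    using insert.prems W' W by auto
  then obtain W'' where W'': "openin T W''" "W'' \<noteq> {}" "W'' \<subseteq> W'"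
    "W'' \<subseteq> U \<or> (\<forall>\<gamma>\<in>U. \<not> (s \<gamma> \<in> W'' \<and> r \<gamma> \<in> W''))"
    using effective_refinement_one[OF eff _ W'(1,2)] by metis
  have "W'' \<subseteq> V \<or> (\<forall>\<gamma>\<in>V. \<not> (s \<gamma> \<in> W'' \<and> r \<gamma> \<in> W''))" if "V \<in> F" for V
    using W'(4) that W''(3) by (meson subset_iff)
  then show ?case
    using W''(1,2,4) subset_trans[OF W''(3) W'(3)] by (intro exI[of _ W'']) simp
qed

text \<open>A member of \<open>F\<close> containing \<open>K\<close> has no arrows from
  \<open>K\<close> to \<open>K\<close> besides the units in \<open>K\<close>, because
  \<open>s\<close> is injective on it; the other members have none at all. Only the coefficients of
  the members containing \<open>K\<close> survive in the corner.\<close>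

lemma compress:
  fixes c :: "'g set \<Rightarrow> 'a::comm_semiring_1"
  assumes K: "cob K" "K \<subseteq> G0" and F: "finite F" "\<forall>U\<in>F. cob U"
    and dich: "\<forall>U\<in>F. K \<subseteq> U \<or> (\<forall>\<gamma>\<in>U. \<not> (s \<gamma> \<in> K \<and> r \<gamma> \<in> K))"
  shows "conv (indicator K) (conv (\<lambda>\<gamma>. \<Sum>U\<in>F. c U * indicator U \<gamma>) (indicator K))
    = (\<lambda>\<gamma>. (\<Sum>U | U \<in> F \<and> K \<subseteq> U. c U) * indicator K \<gamma>)"
proof
  fix \<gamma>
  have "(\<Sum>U\<in>F. c U * indicator U \<gamma>) = (\<Sum>U | U \<in> F \<and> K \<subseteq> U. c U) * indicator K \<gamma>"
    if \<gamma>: "\<gamma> \<in> G" "s \<gamma> \<in> K" "r \<gamma> \<in> K"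
  proof -
    have "(indicator U \<gamma> :: 'a) = (if K \<subseteq> U then indicator K \<gamma> else 0)" if U: "U \<in> F" for U
    proof (cases "K \<subseteq> U")
      case True
      have "\<gamma> \<in> K" if "\<gamma> \<in> U"
      proof -
        have "inj_on s U" "s (s \<gamma>) = s \<gamma>"
          using F(2) U cob_iff s_unit s_in \<gamma> by auto
        then have "s \<gamma> = \<gamma>"
          using inj_onD[of s U "s \<gamma>" \<gamma>] True \<gamma> that by blast
        then show ?thesis
          using \<gamma>(2) by simp
      qed
      then show ?thesis
        using True by (auto simp: indicator_def)
    next
      case False
      then show ?thesis
        using dich U \<gamma> by (auto simp: indicator_def)
    qed
    then have "(\<Sum>U\<in>F. c U * indicator U \<gamma>) = (\<Sum>U\<in>F. if K \<subseteq> U then c U * indicator K \<gamma> else 0)"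
      by (intro sum.cong) auto
    also have "\<dots> = (\<Sum>U | U \<in> F \<and> K \<subseteq> U. c U * indicator K \<gamma>)"
      using F(1) by (simp add: sum.If_cases Int_def)
    finally show ?thesis
      by (simp add: sum_distrib_right)
  qed
  moreover have "\<gamma> \<notin> K" if "\<not> (\<gamma> \<in> G \<and> s \<gamma> \<in> K \<and> r \<gamma> \<in> K)"
    using that K(2) unit_in s_unit r_unit by (metis subsetD)
  ultimately show "conv (indicator K) (conv (\<lambda>\<gamma>. \<Sum>U\<in>F. c U * indicator U \<gamma>) (indicator K)) \<gamma>
    = (\<Sum>U | U \<in> F \<and> K \<subseteq> U. c U) * indicator K \<gamma>"
    unfolding conv_indicator_unit_left[OF K] conv_indicator_unit_right[OF K] by auto
qed

lemma conv_scaled_unit: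
  fixes c :: "'a::comm_semiring_1"
  assumes "cob K" "K \<subseteq> G0"
  shows "conv (\<lambda>\<gamma>. c * indicator K \<gamma>) f = (\<lambda>\<gamma>. c * conv (indicator K) f \<gamma>)"
  using conv_sum_left[of "{K}" "\<lambda>_. c" f] assms(1) by (simp del: sum_mult_indicator)

text \<open>Compact open sets of units are clopen in the unit space, which is Hausdorff. Differences
  are what allows a cover to be made disjoint.\<close>

lemma cob_diff:
  assumes "cob K" "K \<subseteq> G0" "cob L" "L \<subseteq> G0"
  shows "cob (K - L)"
proof -
  have "closedin X L"
    using assms cob_iff[of L] Hausdorff_X by (simp add: compactin_imp_closedin compactin_subtopology)
  moreover have "openin X K"
    using assms cob_iff[of K] openin_X_iff by blast
  ultimately have "openin X (K - L)"
    by (rule openin_diff[rotated])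
  moreover have "compactin X (K - L)"
  proof -
    have "closedin X (G0 - L)"
      using assms cob_iff[of L] openin_X_iff[of L] closedin_diff[OF closedin_topspace, of X L]
      unfolding topspace_X by blast
    then have "compactin X (K \<inter> (G0 - L))"
      using assms cob_iff[of K] by (intro compact_Int_closedin) (simp_all add: compactin_subtopology)
    moreover have "K \<inter> (G0 - L) = K - L"
      using assms by auto
    ultimately show ?thesis by simp
  qed
  ultimately show ?thesis
    using assms by (intro cob_unit) (auto simp: openin_X_iff compactin_subtopology)
qed

lemma conv_scaled_indicators:
  fixes a b :: "'a::comm_semiring_1"
  assumes "cob K" "K \<subseteq> G0"
  shows "conv (\<lambda>\<gamma>. a * indicator K \<gamma>) (\<lambda>\<gamma>. b * indicator K \<gamma>) = (\<lambda>\<gamma>. (a * b) * indicator K \<gamma>)"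
proof
  fix \<gamma>
  have "r \<gamma> \<in> K" "\<gamma> \<in> G" if "\<gamma> \<in> K"
    using that assms(2) r_unit unit_in by (metis subsetD)+
  then show "conv (\<lambda>\<gamma>. a * indicator K \<gamma>) (\<lambda>\<gamma>. b * indicator K \<gamma>) \<gamma> = (a * b) * indicator K \<gamma>"
    unfolding conv_scaled_unit[OF assms] conv_indicator_unit_left[OF assms]
    by (auto simp: indicator_def)
qed

text \<open>The left side is the conjugate of \<open>K\<close> by \<open>B\<close>. Arrows of
  \<open>B\<close> with the same source coincide, so only the products \<open>m b (i b)\<close>,
  which are ranges, survive. This moves congruence to zero from sources to ranges.\<close>

lemma conjugate_unit_set:
  assumes B: "B \<subseteq> G" "inj_on s B" and K: "K \<subseteq> G0" "s ` B \<subseteq> K"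
  shows "set_mult (set_mult B K) (i ` B) = r ` B"
proof (intro equalityI subsetI)
  have BK: "set_mult B K = B"
  proof (intro equalityI subsetI)
    fix x assume "x \<in> set_mult B K"
    then obtain b k where *: "x = m b k" "b \<in> B" "k \<in> K" "s b = r k"
      by (auto simp: set_mult_def)
    then have "k = s b"
      using K(1) r_unit by auto
    then show "x \<in> B"
      using * B(1) m_s by auto
  next
    fix b assume b: "b \<in> B"
    then have "b = m b (s b)" "s b \<in> K"
      using B(1) K m_s by auto
    moreover from this have "s b = r (s b)"
      using K(1) r_unit by auto
    ultimately show "b \<in> set_mult B K"
      using b unfolding set_mult_def by blast
  qed
  show "x \<in> r ` B" if x: "x \<in> set_mult (set_mult B K) (i ` B)" for x
  proof -
    obtain b b' where *: "x = m b (i b')" "b \<in> B" "b' \<in> B" "s b = r (i b')"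
      using x unfolding BK by (auto simp: set_mult_def)
    then have "b' = b"
      using B r_i inj_onD by (metis subsetD)
    then show ?thesis
      using * B(1) m_i_right by auto
  qed
  show "x \<in> set_mult (set_mult B K) (i ` B)" if x: "x \<in> r ` B" for x
  proof -
    obtain b where b: "b \<in> B" "x = r b"
      using x by auto
    then have "x = m b (i b)" "s b = r (i b)"
      using B(1) m_i_right r_i by auto
    then have "x \<in> set_mult B (i ` B)"
      unfolding set_mult_def using b(1) by blast
    then show ?thesis
      by (simp add: BK)
  qed
qed

section \<open>Functions congruent to zero under a fixed congruence\<close>

context
  fixes R :: "(('g \<Rightarrow> 'a::comm_semiring_1) \<times> ('g \<Rightarrow> 'a)) set"
  assumes R: "hemiring_congruence steinberg (\<lambda>f g \<gamma>. f \<gamma> + g \<gamma>) conv R"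
begin

lemma
  shows R_subset: "(f, g) \<in> R \<Longrightarrow> f \<in> steinberg \<and> g \<in> steinberg"
    and R_refl: "f \<in> steinberg \<Longrightarrow> (f, f) \<in> R"
    and R_sym: "(f, g) \<in> R \<Longrightarrow> (g, f) \<in> R"
    and R_trans: "\<lbrakk>(f, g) \<in> R; (g, h) \<in> R\<rbrakk> \<Longrightarrow> (f, h) \<in> R"
    and R_add: "\<lbrakk>(f, g) \<in> R; h \<in> steinberg\<rbrakk> \<Longrightarrow> (\<lambda>\<gamma>. f \<gamma> + h \<gamma>, \<lambda>\<gamma>. g \<gamma> + h \<gamma>) \<in> R"
    and R_left: "\<lbrakk>(f, g) \<in> R; h \<in> steinberg\<rbrakk> \<Longrightarrow> (conv h f, conv h g) \<in> R"
    and R_right: "\<lbrakk>(f, g) \<in> R; h \<in> steinberg\<rbrakk> \<Longrightarrow> (conv f h, conv g h) \<in> R"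
  using R unfolding hemiring_congruence_def equiv_def
  by (blast dest: refl_onD symD transD)+

lemma null_add:
  assumes "(f, \<lambda>_. 0) \<in> R" "(g, \<lambda>_. 0) \<in> R"
  shows "(\<lambda>\<gamma>. f \<gamma> + g \<gamma>, \<lambda>_. 0) \<in> R"
proof -
  have "(\<lambda>\<gamma>. f \<gamma> + g \<gamma>, \<lambda>\<gamma>. 0 + g \<gamma>) \<in> R"
    using R_add[OF assms(1)] R_subset[OF assms(2)] by blast
  then show ?thesis
    using R_trans[OF _ assms(2)] by simp
qed

lemma null_left: "\<lbrakk>(f, \<lambda>_. 0) \<in> R; h \<in> steinberg\<rbrakk> \<Longrightarrow> (conv h f, \<lambda>_. 0) \<in> R"
  using R_left[of f "\<lambda>_. 0" h] by (simp add: conv_zero_right)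

lemma null_right: "\<lbrakk>(f, \<lambda>_. 0) \<in> R; h \<in> steinberg\<rbrakk> \<Longrightarrow> (conv f h, \<lambda>_. 0) \<in> R"
  using R_right[of f "\<lambda>_. 0" h] by (simp add: conv_zero_left)

lemma null_sum:
  assumes "finite F" "\<forall>U\<in>F. (h U, \<lambda>_. 0) \<in> R"
  shows "(\<lambda>\<gamma>. \<Sum>U\<in>F. h U \<gamma>, \<lambda>_. 0) \<in> R"
  using assms by (induction F) (auto simp: R_refl steinberg_zero null_add)

lemma null_subset:
  assumes "(indicator K, \<lambda>_. 0) \<in> R" "cob K" "K \<subseteq> G0" "cob L" "L \<subseteq> K"
  shows "(indicator L, \<lambda>_. 0) \<in> R"
proof -
  have "conv (indicator L) (indicator K) = (indicator L :: 'g \<Rightarrow> 'a)"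
  proof
    fix \<gamma>
    have "\<gamma> \<in> G \<and> r \<gamma> \<in> L \<and> \<gamma> \<in> K \<longleftrightarrow> \<gamma> \<in> L"
      using assms(3,5) r_unit unit_in by (metis subsetD)
    then show "conv (indicator L) (indicator K) \<gamma> = (indicator L \<gamma> :: 'a)"
      using conv_indicator_unit_left[of L "indicator K :: 'g \<Rightarrow> 'a" \<gamma>] assms by (auto simp: indicator_def)
  qed
  then show ?thesis
    using null_left[OF assms(1) steinberg_indicator1[OF assms(4)]] by simp
qed

text \<open>Indicators add up to the indicator of a union only for disjoint pieces, so
  \<open>L\<close> is split along one member \<open>K\<close> of the cover, and the induction
  hypothesis is applied to the part outside \<open>K\<close>.\<close>

lemma null_cover:
  assumes "finite \<F>" "\<forall>K\<in>\<F>. cob K \<and> K \<subseteq> G0 \<and> (indicator K, \<lambda>_. 0) \<in> R"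
    and "cob L" "L \<subseteq> \<Union>\<F>"
  shows "(indicator L, \<lambda>_. 0) \<in> R"
  using assms
proof (induction \<F> arbitrary: L)
  case empty
  then have "indicator L = (\<lambda>_. 0 :: 'a)"
    by auto
  then show ?case
    using R_refl steinberg_zero by simp
next
  case (insert K \<F>)
  have K: "cob K" "K \<subseteq> G0" "(indicator K, \<lambda>_. 0) \<in> R"
    using insert.prems by auto
  have L: "L \<subseteq> G0"
    using insert.prems by blast
  have d: "cob (L - K)"
    using cob_diff insert.prems(2) L K by blast
  moreover have "L - K \<subseteq> \<Union>\<F>"
    using insert.prems(3) by blast
  ultimately have "(indicator (L - K), \<lambda>_. 0) \<in> R"
    using insert.IH insert.prems(1) by blast
  \<comment> \<open>This set is \<open>L \<inter> K\<close>, written as a difference so that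
    \<open>cob_diff\<close> shows it to be compact open.\<close>
  moreover have "(indicator (L - (L - K)), \<lambda>_. 0) \<in> R"
    using cob_diff[OF insert.prems(2) L d] L by (intro null_subset[OF K(3,1,2)]) auto
  ultimately have "(\<lambda>\<gamma>. indicator (L - K) \<gamma> + indicator (L - (L - K)) \<gamma>, \<lambda>_. 0) \<in> R"
    by (rule null_add)
  moreover have "(\<lambda>\<gamma>. indicator (L - K) \<gamma> + indicator (L - (L - K)) \<gamma>) = (indicator L :: 'g \<Rightarrow> 'a)"
    by (auto simp: indicator_def fun_eq_iff)
  ultimately show ?case
    by simp
qed

text \<open>The union of all compact open sets of units with null indicator is open, and conjugation
  by bisections makes it invariant, so minimality makes it all of \<open>G0\<close>. Compactness
  then yields finite covers by such sets.\<close>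

lemma null_unit_imp_total:
  assumes min: "minimal_groupoid T G0 s r"
    and K: "(indicator K, \<lambda>_. 0) \<in> R" "cob K" "K \<subseteq> G0" "K \<noteq> {}"
  shows "R = steinberg \<times> steinberg"
proof -
  let ?N = "{L. cob L \<and> L \<subseteq> G0 \<and> (indicator L, \<lambda>_. 0::'a) \<in> R}"
  have "openin X (\<Union>?N)"
    using cob_iff openin_X_iff by (intro openin_Union) blast
  moreover have "invariant_set T G0 s r (\<Union>?N)"
    unfolding invariant_set_def
  proof (intro conjI ballI impI)
    fix \<gamma> assume \<gamma>: "\<gamma> \<in> G" "s \<gamma> \<in> \<Union>?N"
    then obtain L where L: "cob L" "L \<subseteq> G0" "(indicator L, \<lambda>_. 0) \<in> R" "s \<gamma> \<in> L"
      by auto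
    have "openin T {\<beta> \<in> G. s \<beta> \<in> L}" "\<gamma> \<in> {\<beta> \<in> G. s \<beta> \<in> L}"
      using open_preimage_s[OF openin_topspace] L cob_iff \<gamma> by auto
    then obtain B where B: "cob B" "\<gamma> \<in> B" "B \<subseteq> {\<beta> \<in> G. s \<beta> \<in> L}"
      by (rule cob_base)
    have "inj_on s B"
      using B(1) cob_iff by auto
    then have rB: "set_mult (set_mult B L) (i ` B) = r ` B"
      using B(3) L(2) by (intro conjugate_unit_set) auto
    have "(conv (conv (indicator B) (indicator L)) (indicator (i ` B)), \<lambda>_. 0) \<in> R"
      using L B cob_inverse by (intro null_right null_left steinberg_indicator1) auto
    then have "(indicator (r ` B), \<lambda>_. 0) \<in> R"
      using L(1) B(1) cob_inverse cob_set_mult by (simp add: conv_indicator_indicator rB)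
    moreover have "cob (r ` B)"
      using rB L(1) B(1) cob_inverse cob_set_mult by metis
    moreover have "r ` B \<subseteq> G0"
      using B(3) r_in by auto
    ultimately show "r \<gamma> \<in> \<Union>?N"
      using B(2) by blast
  qed auto
  ultimately have N: "\<Union>?N = G0"
    using min K unfolding minimal_groupoid_def by blast
  have null_unit: "(indicator L, \<lambda>_. 0) \<in> R" if L: "cob L" "L \<subseteq> G0" for L
  proof -
    have "compactin T L"
      using L cob_iff by auto
    moreover have "\<forall>K\<in>?N. openin T K"
      using cob_iff by auto
    moreover have "L \<subseteq> \<Union>?N"
      using N L by simp
    ultimately obtain \<F> where "finite \<F>" "\<F> \<subseteq> ?N" "L \<subseteq> \<Union>\<F>"
      unfolding compactin_def by meson
    then show ?thesis
      by (intro null_cover[OF _ _ L(1)]) auto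
  qed
  have null: "(f, \<lambda>_. 0) \<in> R" if f: "f \<in> steinberg" for f
  proof -
    obtain F c where F: "finite F" "\<forall>U\<in>F. cob U" "f = (\<lambda>\<gamma>. \<Sum>U\<in>F. c U * indicator U \<gamma>)"
      using f by (rule steinbergE)
    have "(\<lambda>\<gamma>. c U * indicator U \<gamma>, \<lambda>_. 0) \<in> R" if "U \<in> F" for U
    proof -
      have U: "cob U" "U \<subseteq> G" "compactin T U" "openin T U"
        using that F(2) cob_subset cob_iff by auto
      have sU: "s ` U \<subseteq> G0"
        using U(2) s_in by auto
      have cob_sU: "cob (s ` U)"
        using cob_unit[OF compact_image_s[OF U(3)] open_image_s[OF U(4)] sU] .
      \<comment> \<open>Restricting sources to \<open>s(U)\<close> changes nothing, so each term of
        \<open>f\<close> is a convolution multiple of a null indicator of units.\<close>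
      have "conv (\<lambda>\<gamma>. c U * indicator U \<gamma>) (indicator (s ` U)) = (\<lambda>\<gamma>. c U * indicator U \<gamma>)"
        using conv_indicator_unit_right[OF cob_sU sU, of "\<lambda>\<gamma>. c U * indicator U \<gamma>"] U(2)
        by (auto simp: fun_eq_iff indicator_def)
      then show ?thesis
        using null_left[OF null_unit[OF cob_sU sU] steinberg_indicator[OF U(1), of "c U"]] by simp
    qed
    then show ?thesis
      unfolding F(3) using null_sum[OF F(1), of "\<lambda>U \<gamma>. c U * indicator U \<gamma>"] by blast
  qed
  have "(f, g) \<in> R" if "f \<in> steinberg" "g \<in> steinberg" for f g
    using R_trans[OF null R_sym[OF null]] that by blast
  then show ?thesis
    using R_subset by auto
qed

text \<open>Over a field, subtract \<open>b\<close> and divide by the difference: \<open>y\<close>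
  is the negative of \<open>b\<close>, and \<open>z\<close> the inverse of \<open>a + y\<close>.
  Over the Boolean semifield distinct coefficients are \<open>0\<close> and \<open>1\<close>, so the
  given pair is already the wanted one up to order.\<close>

lemma distinct_multiples_imp_null:
  assumes S: "is_field TYPE('a) \<or> is_boolean_semifield TYPE('a)"
    and K: "cob K" "K \<subseteq> G0"
    and ab: "(\<lambda>\<gamma>. a * indicator K \<gamma>, \<lambda>\<gamma>. b * indicator K \<gamma>) \<in> R" "a \<noteq> b"
  shows "(indicator K, \<lambda>_. 0) \<in> R"
  using S
proof
  assume field: "is_field TYPE('a)"
  then obtain y where y: "b + y = 0"
    by (auto simp: is_field_def)
  have "a + y \<noteq> 0"
  proof
    assume "a + y = 0"
    then have "a = b"
      using y by (metis add.commute add.left_commute add_0_right)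
    with ab(2) show False ..
  qed
  then obtain z where z: "(a + y) * z = 1"
    using field by (auto simp: is_field_def semifield_def)
  have "(\<lambda>\<gamma>. a * indicator K \<gamma> + y * indicator K \<gamma>, \<lambda>\<gamma>. b * indicator K \<gamma> + y * indicator K \<gamma>) \<in> R"
    using R_add[OF ab(1) steinberg_indicator[OF K(1)]] .
  then have "(\<lambda>\<gamma>. (a + y) * indicator K \<gamma>, \<lambda>_. 0) \<in> R"
    by (simp add: distrib_right[symmetric] y)
  then have "(conv (\<lambda>\<gamma>. (a + y) * indicator K \<gamma>) (\<lambda>\<gamma>. z * indicator K \<gamma>), \<lambda>_. 0) \<in> R"
    using steinberg_indicator[OF K(1)] by (rule null_right)
  then show ?thesis
    unfolding conv_scaled_indicators[OF K] z by simp
next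
  assume "is_boolean_semifield TYPE('a)"
  then have "x = 0 \<or> x = 1" for x :: 'a
    unfolding is_boolean_semifield_def by blast
  then have "a = 0 \<and> b = 1 \<or> a = 1 \<and> b = 0"
    using ab(2) by metis
  then show ?thesis
    using ab(1) R_sym by auto
qed

lemma congruence_trivial:
  assumes S: "is_field TYPE('a) \<or> is_boolean_semifield TYPE('a)"
    and min: "minimal_groupoid T G0 s r" and eff: "effective_groupoid T G0 s r"
    and fg: "(f, g) \<in> R" and nd: "T closure_of {\<alpha> \<in> G. f \<alpha> = g \<alpha>} \<noteq> G"
  shows "R = steinberg \<times> steinberg"
proof -
  \<comment> \<open>Off the closure of the set of agreement the functions differ at every arrow of
    an open set, not just at one arrow.\<close>
  obtain V where V: "openin T V" "V \<noteq> {}" "{\<alpha> \<in> G. f \<alpha> = g \<alpha>} \<inter> V = {}"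
    using nd unfolding dense_intersects_open by blast
  then obtain B where B: "cob B" "B \<noteq> {}" "B \<subseteq> V"
    using cob_base[OF V(1)] by blast
  have BG: "B \<subseteq> G" "openin T B"
    using B(1) cob_subset cob_iff by auto
  \<comment> \<open>Translation by the inverse bisection moves the value at an arrow of
    \<open>B\<close> to its source, so the new functions differ at every unit of
    \<open>s(B)\<close>.\<close>
  define f' where "f' = conv (indicator (i ` B)) f"
  define g' where "g' = conv (indicator (i ` B)) g"
  have fg': "(f', g') \<in> R"
    unfolding f'_def g'_def using R_left[OF fg steinberg_indicator1[OF cob_inverse[OF B(1)]]] .
  have neq: "f' u \<noteq> g' u" if u: "u \<in> s ` B" for u
  proof -
    obtain b where b: "b \<in> B" "u = s b" "b \<in> G"
      using u BG by auto
    then have "u = m (i b) b" "s (i b) = r b" "i b \<in> i ` B"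
      by (simp_all add: m_i_left s_i)
    then have "f' u = f b" "g' u = g b"
      unfolding f'_def g'_def using conv_indicator_left[OF cob_inverse[OF B(1)]] b by auto
    then show ?thesis
      using V(3) B(3) b by auto
  qed
  have "f' \<in> steinberg" "g' \<in> steinberg"
    using R_subset[OF fg'] by auto
  then obtain F c d where F: "finite F" "\<forall>U\<in>F. cob U"
    "f' = (\<lambda>\<gamma>. \<Sum>U\<in>F. c U * indicator U \<gamma>)" "g' = (\<lambda>\<gamma>. \<Sum>U\<in>F. d U * indicator U \<gamma>)"
    by (rule steinberg_common)
  have "openin T (s ` B)" "s ` B \<noteq> {}" "s ` B \<subseteq> G0"
    using open_image_s BG B(2) s_in by auto
  then obtain W where W: "openin T W" "W \<noteq> {}" "W \<subseteq> s ` B"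
    "\<forall>U\<in>F. W \<subseteq> U \<or> (\<forall>\<gamma>\<in>U. \<not> (s \<gamma> \<in> W \<and> r \<gamma> \<in> W))"
    using effective_refinement[OF eff F(1,2)] by metis
  then obtain u where u: "u \<in> W" "u \<in> G0"
    using \<open>s ` B \<subseteq> G0\<close> by blast
  obtain K where K: "cob K" "u \<in> K" "K \<subseteq> W" "K \<subseteq> G0"
    using unit_cob_base[OF W(1) u] .
  have dich: "\<forall>U\<in>F. K \<subseteq> U \<or> (\<forall>\<gamma>\<in>U. \<not> (s \<gamma> \<in> K \<and> r \<gamma> \<in> K))"
    using W(4) K(3) by (meson subset_iff)
  define a where "a = (\<Sum>U | U \<in> F \<and> K \<subseteq> U. c U)"
  define b where "b = (\<Sum>U | U \<in> F \<and> K \<subseteq> U. d U)"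
  have a: "conv (indicator K) (conv f' (indicator K)) = (\<lambda>\<gamma>. a * indicator K \<gamma>)"
    unfolding F(3) a_def by (rule compress[OF K(1,4) F(1,2) dich])
  have b: "conv (indicator K) (conv g' (indicator K)) = (\<lambda>\<gamma>. b * indicator K \<gamma>)"
    unfolding F(4) b_def by (rule compress[OF K(1,4) F(1,2) dich])
  \<comment> \<open>Compression keeps the value at the unit \<open>u\<close> of \<open>K\<close>, so
    \<open>f' u \<noteq> g' u\<close> yields \<open>a \<noteq> b\<close>.\<close>
  have corner: "conv (indicator K) (conv h (indicator K)) u = h u" for h :: "'g \<Rightarrow> 'a"
    unfolding conv_indicator_unit_left[OF K(1,4)] conv_indicator_unit_right[OF K(1,4)]
    using K(2) u(2) unit_in s_unit r_unit by simp
  have "a \<noteq> b"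
    using fun_cong[OF a, of u] fun_cong[OF b, of u] corner[of f'] corner[of g'] neq[of u] K(2) u(1) W(3)
    by auto
  moreover have "(\<lambda>\<gamma>. a * indicator K \<gamma>, \<lambda>\<gamma>. b * indicator K \<gamma>) \<in> R"
    using R_left[OF R_right[OF fg' steinberg_indicator1[OF K(1)]] steinberg_indicator1[OF K(1)]]
    unfolding a b .
  ultimately have "(indicator K, \<lambda>_. 0) \<in> R"
    using distinct_multiples_imp_null[OF S K(1,4)] by blast
  then show ?thesis
    using null_unit_imp_total[OF min _ K(1,4)] K(2) by blast
qed

end

lemma sufficient_conditions:
  assumes "is_field TYPE('a::comm_semiring_1) \<or> is_boolean_semifield TYPE('a)"
    and "minimal_groupoid T G0 s r" "effective_groupoid T G0 s r"
    and "\<forall>f \<in> steinberg_algebra T s r TYPE('a). \<forall>g \<in> steinberg_algebra T s r TYPE('a).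
      f \<noteq> g \<longrightarrow> T closure_of {\<alpha> \<in> topspace T. f \<alpha> = g \<alpha>} \<noteq> topspace T"
  shows "steinberg_congruence_simple T s r m TYPE('a)"
  unfolding steinberg_congruence_simple_def congruence_simple_def
proof (intro allI impI)
  fix R :: "(('g \<Rightarrow> 'a) \<times> ('g \<Rightarrow> 'a)) set"
  assume R: "hemiring_congruence steinberg (\<lambda>f g \<gamma>. f \<gamma> + g \<gamma>) conv R"
  show "R = steinberg \<times> steinberg \<or> R = Id_on steinberg"
  proof (cases "\<exists>f g. (f, g) \<in> R \<and> f \<noteq> g")
    case True
    then obtain f g where fg: "(f, g) \<in> R" "f \<noteq> g"
      by blast
    then have "T closure_of {\<alpha> \<in> G. f \<alpha> = g \<alpha>} \<noteq> G"
      using assms(4) R_subset[OF R fg(1)] by blast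
    then show ?thesis
      using congruence_trivial[OF R assms(1-3) fg(1)] by blast
  next
    case False
    then have "R = Id_on steinberg"
      using R_refl[OF R] R_subset[OF R] by (auto simp: Id_on_iff)
    then show ?thesis ..
  qed
qed

end

theorem theorem3p8:
  fixes T :: "'g topology" and G0 :: "'g set" and s r :: "'g \<Rightarrow> 'g"
    and m :: "'g \<Rightarrow> 'g \<Rightarrow> 'g" and i :: "'g \<Rightarrow> 'g"
  assumes "ample_groupoid T G0 s r m i"
    and "second_countable T"
    and "G0 \<noteq> {}"
    and "semifield TYPE('a::comm_semiring_1)"
  shows "steinberg_congruence_simple T s r m TYPE('a) \<longleftrightarrow>
           ((is_field TYPE('a) \<or> is_boolean_semifield TYPE('a)) \<and>
            minimal_groupoid T G0 s r \<and> effective_groupoid T G0 s r \<and>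
            (\<forall>f \<in> steinberg_algebra T s r TYPE('a). \<forall>g \<in> steinberg_algebra T s r TYPE('a).
               f \<noteq> g \<longrightarrow> T closure_of {\<alpha> \<in> topspace T. f \<alpha> = g \<alpha>} \<noteq> topspace T))"
proof -
  interpret ample T G0 s r m i
    using assms(1) by unfold_locales
  show ?thesis
    using simple_imp_field_or_boolean[OF assms(4,3)] simple_imp_minimal simple_imp_effective
      simple_imp_not_dense[OF _ assms(3)] sufficient_conditions
    by blast
qed

end
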